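(* Let $r\geq 3$ and $k\geq 1$ be fixed integers. Then for all sufficiently large $n$ (depending on $r$ and $k$), if $G$ is a $B_{r,k}$-free graph on $n$ vertices, then \[ q(G)\leq q(T_{n,r}), \] with equality if and only if $G=T_{n,r}$ (up to isomorphism).
   Context: All graphs are finite and simple. A graph is $F$-free if it contains no subgraph (not necessarily induced) isomorphic to $F$. The join $G\vee H$ of two vertex-disjoint graphs is obtained from their union by joining each vertex of $G$ to each vertex of $H$. The generalized book is $B_{r,k}=K_r\vee I_k$, where $K_r$ is the complete graph on $r$ vertices and $I_k$ is an independent set (edgeless graph) on $k$ vertices. The Turán graph $T_{n,r}$ is the complete $r$-partite graph on $n$ vertices whose partite sets are as equal in size as possible. The signless Laplacian matrix of $G$ is $Q(G)=D(G)+A(G)$, where $D(G)$ is the diagonal matrix of vertex degrees and $A(G)$ is the adjacency matrix; $q(G)$ is the maximum modulus of the eigenvalues of $Q(G)$. *)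

theory Defs
  imports
    "Graph_Theory.Graph_Theory"
    "Jordan_Normal_Form.Spectral_Radius"
begin

text \<open>
  A finite simple graph is a \<^typ>\<open>'a pair_pre_digraph\<close> satisfying \<^const>\<open>pair_graph\<close>: finite,
  loopless and symmetric, each edge \<open>{u, v}\<close> being represented by the two arcs \<open>(u, v)\<close> and
  \<open>(v, u)\<close>. Subgraphs and isomorphisms are those of the library, applied via \<^const>\<open>with_proj\<close>.
\<close>

definition graph_isomorphic :: "'a pair_pre_digraph \<Rightarrow> 'b pair_pre_digraph \<Rightarrow> bool" where
  "graph_isomorphic G H \<longleftrightarrow> digraph_iso (with_proj G) (with_proj H)"

definition graph_free :: "'b pair_pre_digraph \<Rightarrow> 'a pair_pre_digraph \<Rightarrow> bool" where
  "graph_free F G \<longleftrightarrow>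
     \<not> (\<exists>H. subgraph (with_proj H) (with_proj G) \<and> graph_isomorphic H F)"

definition complete_graph :: "'a set \<Rightarrow> 'a pair_pre_digraph" where
  "complete_graph V = \<lparr>pverts = V, parcs = {(u, v). u \<in> V \<and> v \<in> V \<and> u \<noteq> v}\<rparr>"

definition edgeless_graph :: "'a set \<Rightarrow> 'a pair_pre_digraph" where
  "edgeless_graph V = \<lparr>pverts = V, parcs = {}\<rparr>"

text \<open>Only meaningful if the vertex sets of the two graphs are disjoint.\<close>

definition graph_join ::
    "'a pair_pre_digraph \<Rightarrow> 'a pair_pre_digraph \<Rightarrow> 'a pair_pre_digraph" where
  "graph_join G H =
     \<lparr>pverts = pverts G \<union> pverts H,
      parcs = parcs G \<union> parcs H \<union> pverts G \<times> pverts H \<union> pverts H \<times> pverts G\<rparr>"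

definition generalized_book :: "nat \<Rightarrow> nat \<Rightarrow> nat pair_pre_digraph" where
  "generalized_book r k = graph_join (complete_graph {..<r}) (edgeless_graph {r..<r + k})"

text \<open>
  The partite sets are the residue classes modulo \<open>r\<close>; lemma \<open>card_turan_part\<close> below shows that
  their sizes are as equal as possible.
\<close>

definition turan_graph :: "nat \<Rightarrow> nat \<Rightarrow> nat pair_pre_digraph" where
  "turan_graph n r =
     \<lparr>pverts = {..<n}, parcs = {(u, v). u < n \<and> v < n \<and> u mod r \<noteq> v mod r}\<rparr>"

text \<open>
  Matrices are indexed by \<open>{..<n}\<close>, so they are taken with respect to an enumeration \<open>vs\<close> of the
  vertices. Different enumerations give permutation-similar matrices, so the choice made in
  \<open>signless_laplacian_radius\<close> does not affect its value.
\<close>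

definition adjacency_matrix :: "'a list \<Rightarrow> 'a pair_pre_digraph \<Rightarrow> complex mat" where
  "adjacency_matrix vs G =
     mat (length vs) (length vs) (\<lambda>(i, j). if (vs ! i, vs ! j) \<in> parcs G then 1 else 0)"

definition degree_matrix :: "'a list \<Rightarrow> 'a pair_pre_digraph \<Rightarrow> complex mat" where
  "degree_matrix vs G =
     mat (length vs) (length vs)
       (\<lambda>(i, j). if i = j then of_nat (out_degree (with_proj G) (vs ! i)) else 0)"

definition signless_laplacian :: "'a list \<Rightarrow> 'a pair_pre_digraph \<Rightarrow> complex mat" where
  "signless_laplacian vs G = degree_matrix vs G + adjacency_matrix vs G"

definition signless_laplacian_radius :: "'a pair_pre_digraph \<Rightarrow> real" where
  "signless_laplacian_radius G =
     spectral_radius (signless_laplacian (SOME vs. distinct vs \<and> set vs = pverts G) G)"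

lemma pair_graph_generalized_book: "pair_graph (generalized_book r k)"
proof -
  let ?B = "generalized_book r k"
  have fin: "finite (pverts ?B)" and sub: "parcs ?B \<subseteq> pverts ?B \<times> pverts ?B"
    by (auto simp: generalized_book_def graph_join_def complete_graph_def edgeless_graph_def)
  have "finite (parcs ?B)"
    using sub fin by (meson finite_SigmaI finite_subset)
  moreover have "symmetric (with_proj ?B)"
    unfolding symmetric_def
    by (auto simp: generalized_book_def graph_join_def complete_graph_def edgeless_graph_def
        intro!: symI)
  moreover have "fst e \<noteq> snd e" if "e \<in> parcs ?B" for e
    using that
    by (auto simp: generalized_book_def graph_join_def complete_graph_def edgeless_graph_def)
  ultimately show ?thesis
    using fin sub by unfold_locales auto
qed

lemma pair_graph_turan_graph: "pair_graph (turan_graph n r)"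
proof -
  let ?T = "turan_graph n r"
  have fin: "finite (pverts ?T)" and sub: "parcs ?T \<subseteq> pverts ?T \<times> pverts ?T"
    by (auto simp: turan_graph_def)
  have "finite (parcs ?T)"
    using sub fin by (meson finite_SigmaI finite_subset)
  moreover have "symmetric (with_proj ?T)"
    unfolding symmetric_def by (auto simp: turan_graph_def intro!: symI)
  moreover have "fst e \<noteq> snd e" if "e \<in> parcs ?T" for e
    using that by (auto simp: turan_graph_def)
  ultimately show ?thesis
    using fin sub by unfold_locales auto
qed

lemma card_turan_part:
  assumes "i < r"
  shows "card {v. v < n \<and> v mod r = i} = n div r + (if i < n mod r then 1 else 0)"
proof -
  have "{v. v < n \<and> v mod r = i} =
        (\<lambda>m. m * r + i) ` {..<n div r + (if i < n mod r then 1 else 0)}" (is "?L = ?f ` ?I")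
  proof
    show "?f ` ?I \<subseteq> ?L"
    proof
      fix v assume "v \<in> ?f ` ?I"
      then obtain m where m: "v = m * r + i" "m < n div r + (if i < n mod r then 1 else 0)"
        by auto
      have "v < n"
      proof (cases "m < n div r")
        case True
        then have "Suc m * r \<le> (n div r) * r" by (intro mult_le_mono1) simp
        moreover have "(n div r) * r \<le> n" by simp
        ultimately show ?thesis unfolding m(1) mult_Suc using assms by linarith
      next
        case False
        then have "m = n div r" "i < n mod r" using m(2) by (auto split: if_splits)
        moreover have "(n div r) * r + i < n" if "i < n mod r"
          using that div_mult_mod_eq[of n r] by linarith
        ultimately show ?thesis using m(1) by simp
      qed
      then show "v \<in> ?L" using m(1) assms by simp
    qed
    show "?L \<subseteq> ?f ` ?I"
    proof
      fix v assume v: "v \<in> ?L"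
      then have eq: "v = (v div r) * r + i" using div_mult_mod_eq[of v r] by simp
      have le: "v div r \<le> n div r" using v by (intro div_le_mono) simp
      have "i < n mod r" if "v div r = n div r"
      proof -
        have "(n div r) * r + i < n" using v eq that by simp
        then show ?thesis using div_mult_mod_eq[of n r] by linarith
      qed
      then have "v div r \<in> ?I" using le by (cases "v div r = n div r") auto
      then show "v \<in> ?f ` ?I" using eq by blast
    qed
  qed
  moreover have "inj_on ?f ?I" using assms by (intro inj_onI) simp
  ultimately show ?thesis by (simp add: card_image)
qed

end

theory Submission
  imports Defs "HOL-Analysis.Function_Topology" "HOL-Analysis.Convex"
begin

text \<open>
  Let \<open>q(W)\<close> be the largest eigenvalue of the signless Laplacian of the subgraph induced by \<open>W\<close>,
  put \<open>a = 1 - 1/r\<close>, and let \<open>G\<close> be a \<open>B\<^sub>r\<^sub>,\<^sub>k\<close>-free graph on \<open>n\<close> vertices whose index is at least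
  that of the Turan graph, hence at least \<open>2an - 2r/n\<close>. Three facts force \<open>G\<close> to be the Turan graph.

  \<^item> A book-free graph of minimum degree close to \<open>an\<close> is \<open>r\<close>-partite. Fix an \<open>r\<close>-clique \<open>K\<close>; by
    freeness almost every vertex misses exactly one vertex of \<open>K\<close>, and this sorts the vertices into
    \<open>r\<close> classes of nearly equal size that are nearly completely joined to each other. A vertex with
    many neighbours in all classes, or an edge inside a class, extends greedily to an \<open>r\<close>-clique with
    \<open>k\<close> common neighbours (locale \<open>dense_book_free\<close>).

  \<^item> The minimum degree comes from an extremal choice. Among all nonempty vertex sets let \<open>W\<close> maximize
    \<open>q(W) / |W|\<^sup>p\<close>, where \<open>p = 1 - \<kappa>\<close> is slightly below \<open>1\<close>. Deleting the vertex with the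
    smallest entry of the Perron vector cannot increase this ratio, and the Rayleigh quotient turns
    that into a lower bound on the smallest entry: the Perron vector is nearly constant. Here
    \<open>q(W)\<close> must exceed \<open>|W|\<close> by a constant factor, which is where \<open>r \<ge> 3\<close> enters. The
    eigenvector equation at a vertex then makes its degree nearly \<open>a|W|\<close>, so \<open>W\<close> induces an
    \<open>r\<close>-partite graph and \<open>q(W) \<le> 2a|W|\<close>. If \<open>W\<close> were a proper subset, the choice of \<open>W\<close>
    would push \<open>q(G)\<close> below \<open>2an - 2r/n\<close>. So \<open>W\<close> consists of all vertices
    (\<open>near_extremal_book_free_is_colourable\<close>).

  \<^item> For an \<open>r\<close>-partite graph with part sizes \<open>n\<^sub>i\<close>, summing the eigenvector equation over the parts
    gives \<open>\<Sum>\<^sub>i f(n\<^sub>i) \<ge> 1\<close> with \<open>f(t) = t / (c + 2t)\<close> and \<open>c = q - n\<close>; equality forces a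
    complete multipartite graph. As \<open>f\<close> is concave, the sum is largest, among integer sizes, exactly
    for the balanced ones, and for those the inequality \<open>\<Sum>\<^sub>i f(t\<^sub>i) \<ge> 1\<close> says, via the test vector
    \<open>1 / (c + 2t\<^sub>i)\<close>, that the Turan graph has index at least \<open>q\<close> (\<open>compare_with_turan\<close>).
\<close>

section \<open>The signless Laplacian as a quadratic form\<close>

text \<open>
  A graph is represented by a symmetric irreflexive relation \<open>E\<close> together with a vertex set \<open>W\<close>,
  so that passing to an induced subgraph only changes \<open>W\<close>.
\<close>

definition nbrs :: "'a rel \<Rightarrow> 'a set \<Rightarrow> 'a \<Rightarrow> 'a set" where
  "nbrs E W u = {v \<in> W. (u, v) \<in> E}"

definition sl_apply :: "'a rel \<Rightarrow> 'a set \<Rightarrow> ('a \<Rightarrow> real) \<Rightarrow> 'a \<Rightarrow> real" where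
  "sl_apply E W x u = (\<Sum>v\<in>nbrs E W u. x u + x v)"

definition sl_form :: "'a rel \<Rightarrow> 'a set \<Rightarrow> ('a \<Rightarrow> real) \<Rightarrow> real" where
  "sl_form E W x = (\<Sum>u\<in>W. x u * sl_apply E W x u)"

text \<open>
  The supremum of the Rayleigh quotient of the signless Laplacian over the unit sphere. It is used in
  place of the spectral radius of a matrix because it needs no enumeration of the vertices.
\<close>

definition sl_index :: "'a rel \<Rightarrow> 'a set \<Rightarrow> real" where
  "sl_index E W = (SUP x \<in> {x. (\<Sum>u\<in>W. (x u)\<^sup>2) = 1}. sl_form E W x)"

lemma nbrs_subset: "nbrs E W u \<subseteq> W"
  by (auto simp: nbrs_def)

lemma finite_nbrs [simp]: "finite W \<Longrightarrow> finite (nbrs E W u)"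
  by (auto simp: nbrs_def)

lemma card_nbrs_le: "finite W \<Longrightarrow> card (nbrs E W u) \<le> card W"
  by (intro card_mono nbrs_subset)

lemma sum_nbrs_swap:
  assumes "finite W" "sym E"
  shows "(\<Sum>u\<in>W. \<Sum>v\<in>nbrs E W u. f u v) = (\<Sum>u\<in>W. \<Sum>v\<in>nbrs E W u. f v u)"
proof -
  have "(\<Sum>u\<in>W. \<Sum>v\<in>{v\<in>W. (u, v) \<in> E}. f u v) = (\<Sum>v\<in>W. \<Sum>u\<in>{u\<in>W. (u, v) \<in> E}. f u v)"
    using assms by (intro sum.swap_restrict) auto
  also have "\<dots> = (\<Sum>u\<in>W. \<Sum>v\<in>{v\<in>W. (u, v) \<in> E}. f v u)"
    using assms(2) by (intro sum.cong) (auto dest: symD)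
  finally show ?thesis by (simp add: nbrs_def)
qed

lemma sl_apply_altdef:
  fixes x :: "'a \<Rightarrow> real"
  shows
  "sl_apply E W x u = card (nbrs E W u) * x u + (\<Sum>v\<in>nbrs E W u. x v)"
  by (simp add: sl_apply_def sum.distrib)

lemma twice_sl_form_eq_sum_squares:
  fixes x :: "'a \<Rightarrow> real"
  assumes "finite W" "sym E"
  shows "2 * sl_form E W x = (\<Sum>u\<in>W. \<Sum>v\<in>nbrs E W u. (x u + x v)\<^sup>2)"
proof -
  have 1: "sl_form E W x = (\<Sum>u\<in>W. \<Sum>v\<in>nbrs E W u. x u * (x u + x v))"
    by (simp only: sl_form_def sl_apply_def sum_distrib_left)
  also have "\<dots> = (\<Sum>u\<in>W. \<Sum>v\<in>nbrs E W u. x v * (x v + x u))"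
    by (rule sum_nbrs_swap[OF assms])
  finally have 2: "sl_form E W x = (\<Sum>u\<in>W. \<Sum>v\<in>nbrs E W u. x v * (x v + x u))" .
  have "(\<Sum>u\<in>W. \<Sum>v\<in>nbrs E W u. (x u + x v)\<^sup>2)
      = (\<Sum>u\<in>W. \<Sum>v\<in>nbrs E W u. x u * (x u + x v) + x v * (x v + x u))"
    by (intro sum.cong refl) (simp add: power2_eq_square algebra_simps)
  also have "\<dots> = (\<Sum>u\<in>W. \<Sum>v\<in>nbrs E W u. x u * (x u + x v))
      + (\<Sum>u\<in>W. \<Sum>v\<in>nbrs E W u. x v * (x v + x u))"
    by (simp only: sum.distrib)
  finally show ?thesis
    using 1 2 by linarith
qed

lemma sl_form_le_degrees:
  fixes x :: "'a \<Rightarrow> real"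
  assumes "finite W" "sym E"
  shows "sl_form E W x \<le> 2 * (\<Sum>u\<in>W. card (nbrs E W u) * (x u)\<^sup>2)"
proof -
  have "2 * sl_form E W x \<le> (\<Sum>u\<in>W. \<Sum>v\<in>nbrs E W u. 2 * (x u)\<^sup>2 + 2 * (x v)\<^sup>2)"
    unfolding twice_sl_form_eq_sum_squares[OF assms]
    by (intro sum_mono) (smt (verit) sum_squares_bound power2_sum)
  also have "\<dots> = (\<Sum>u\<in>W. \<Sum>v\<in>nbrs E W u. 2 * (x u)\<^sup>2) + (\<Sum>u\<in>W. \<Sum>v\<in>nbrs E W u. 2 * (x v)\<^sup>2)"
    by (simp add: sum.distrib)
  also have "(\<Sum>u\<in>W. \<Sum>v\<in>nbrs E W u. 2 * (x v)\<^sup>2) = (\<Sum>u\<in>W. \<Sum>v\<in>nbrs E W u. 2 * (x u)\<^sup>2)"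
    by (rule sum_nbrs_swap[OF assms])
  finally have "sl_form E W x \<le> (\<Sum>u\<in>W. \<Sum>v\<in>nbrs E W u. 2 * (x u)\<^sup>2)"
    by simp
  also have "\<dots> = 2 * (\<Sum>u\<in>W. card (nbrs E W u) * (x u)\<^sup>2)"
    unfolding sum_distrib_left by (intro sum.cong) simp_all
  finally show ?thesis .
qed

lemma sl_form_perturb:
  fixes x :: "'a \<Rightarrow> real"
  assumes "finite W" "sym E" "u \<in> W" "(u, u) \<notin> E"
  shows "sl_form E W (x(u := x u + t))
       = sl_form E W x + 2 * t * sl_apply E W x u + t\<^sup>2 * card (nbrs E W u)"
proof -
  define y where "y = x(u := x u + t)"
  let ?d = "real (card (nbrs E W u))"
  have uv: "u \<in> nbrs E W w \<longleftrightarrow> (u, w) \<in> E" for w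
    using assms by (auto simp: nbrs_def dest: symD)
  have y: "y w = x w + (if w = u then t else 0)" for w
    by (simp add: y_def)
  have ay: "sl_apply E W y w = sl_apply E W x w + (if w = u then t * ?d else 0)
      + (if (u, w) \<in> E then t else 0)" for w
  proof -
    have "(\<Sum>v\<in>nbrs E W w. y v) = (\<Sum>v\<in>nbrs E W w. x v) + (if (u, w) \<in> E then t else 0)"
      unfolding uv[symmetric] using assms(1) by (simp add: y sum.distrib)
    then show ?thesis
      unfolding sl_apply_altdef by (simp add: y[of w] algebra_simps)
  qed
  have "sl_form E W y = (\<Sum>w\<in>W. x w * sl_apply E W y w) + (\<Sum>w\<in>W. if w = u then t * sl_apply E W y w else 0)"
    unfolding sl_form_def sum.distrib[symmetric] by (intro sum.cong) (auto simp: y algebra_simps)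
  also have "(\<Sum>w\<in>W. if w = u then t * sl_apply E W y w else 0) = t * sl_apply E W y u"
    using assms by simp
  also have "\<dots> = t * (sl_apply E W x u + t * ?d)"
    using assms(4) by (simp add: ay)
  also have "(\<Sum>w\<in>W. x w * sl_apply E W y w) = (\<Sum>w\<in>W. x w * sl_apply E W x w)
      + (\<Sum>w\<in>W. if w = u then x w * (t * ?d) else 0) + (\<Sum>w\<in>W. if (u, w) \<in> E then x w * t else 0)"
    unfolding sum.distrib[symmetric] by (intro sum.cong) (auto simp: ay algebra_simps)
  also have "(\<Sum>w\<in>W. if w = u then x w * (t * ?d) else 0) = x u * (t * ?d)"
    using assms by simp
  also have "(\<Sum>w\<in>W. if (u, w) \<in> E then x w * t else 0) = (\<Sum>w\<in>nbrs E W u. x w) * t"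
    using assms(1) unfolding nbrs_def sum_distrib_right
    by (simp add: sum.inter_filter del: sum_distrib_right)
  finally show ?thesis
    unfolding y_def[symmetric] sl_form_def[symmetric]
    by (simp add: sl_apply_altdef power2_eq_square algebra_simps)
qed

lemma sl_form_scale: "sl_form E W (\<lambda>u. c * x u) = c\<^sup>2 * sl_form E W x"
proof -
  have "sl_apply E W (\<lambda>u. c * x u) u = c * sl_apply E W x u" for u
    by (simp add: sl_apply_def sum_distrib_left algebra_simps)
  then show ?thesis
    by (simp add: sl_form_def sum_distrib_left power2_eq_square algebra_simps)
qed

lemma sl_form_abs_ge:
  "sl_form E W x \<le> sl_form E W (\<lambda>u. \<bar>x u\<bar>)"
proof -
  have "x u * (x u + x v) \<le> \<bar>x u\<bar> * (\<bar>x u\<bar> + \<bar>x v\<bar>)" for u v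
    using abs_ge_self[of "x u * x v"] by (simp add: distrib_left abs_mult)
  then show ?thesis
    unfolding sl_form_def sl_apply_def sum_distrib_left by (intro sum_mono) auto
qed

text \<open>
  Compactness, in the product topology on all functions: the coordinates outside \<open>W\<close> are irrelevant
  for the form, so the cube over the whole type can replace a cube over \<open>W\<close>.
\<close>

lemma sl_form_attains_sup:
  assumes "finite W" "W \<noteq> {}"
  shows "\<exists>x :: 'a \<Rightarrow> real. (\<Sum>u\<in>W. (x u)\<^sup>2) = 1 \<and>
    (\<forall>y :: 'a \<Rightarrow> real. (\<Sum>u\<in>W. (y u)\<^sup>2) = 1 \<longrightarrow> sl_form E W y \<le> sl_form E W x)"
proof -
  define C where "C = (PiE UNIV (\<lambda>_. {-1..1}) :: ('a \<Rightarrow> real) set)"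
  define S where "S = C \<inter> {x. (\<Sum>u\<in>W. (x u)\<^sup>2) = 1}"
  have "compactin (product_topology (\<lambda>_. euclidean) UNIV) C"
    unfolding C_def compactin_PiE by simp
  then have "compact C"
    by (simp add: euclidean_product_topology)
  moreover have "closed {x :: 'a \<Rightarrow> real. (\<Sum>u\<in>W. (x u)\<^sup>2) = 1}"
    by (intro closed_Collect_eq continuous_intros continuous_on_product_coordinates)
  ultimately have "compact S"
    unfolding S_def by (rule compact_Int_closed)
  moreover obtain w where w: "w \<in> W" using assms by auto
  have "(\<lambda>u. if u = w then 1 else (0::real)) \<in> C"
    by (simp add: C_def PiE_def)
  then have "(\<lambda>u. if u = w then 1 else 0) \<in> S"
    using assms w by (simp add: S_def if_distrib[of "\<lambda>t. t\<^sup>2"] cong: if_cong)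
  then have "S \<noteq> {}" by auto
  moreover have "continuous_on S (sl_form E W)"
    unfolding sl_form_def sl_apply_def
    by (intro continuous_intros continuous_on_subset[OF continuous_on_product_coordinates subset_UNIV])
  ultimately obtain x where x: "x \<in> S" "\<forall>y\<in>S. sl_form E W y \<le> sl_form E W x"
    using continuous_attains_sup[of S "sl_form E W"] by blast
  show ?thesis
  proof (intro exI[of _ x] conjI allI impI)
    show "(\<Sum>u\<in>W. (x u)\<^sup>2) = 1" using x(1) by (simp add: S_def)
    fix y :: "'a \<Rightarrow> real" assume y: "(\<Sum>u\<in>W. (y u)\<^sup>2) = 1"
    define z where "z = (\<lambda>u. if u \<in> W then y u else 0)"
    have z1: "(\<Sum>u\<in>W. (z u)\<^sup>2) = 1" using y by (simp add: z_def)
    have "\<bar>z u\<bar> \<le> 1" for u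
    proof (cases "u \<in> W")
      case True
      then have "(z u)\<^sup>2 \<le> 1" using member_le_sum[of u W "\<lambda>u. (z u)\<^sup>2"] assms(1) z1 by simp
      then show ?thesis by (simp add: abs_square_le_1)
    qed (simp add: z_def)
    then have "z \<in> S" using z1 by (auto simp: S_def C_def abs_le_iff minus_le_iff)
    then have "sl_form E W z \<le> sl_form E W x" using x(2) by blast
    moreover have "sl_form E W z = sl_form E W y"
      unfolding sl_form_def sl_apply_def using nbrs_subset[of E W]
      by (intro sum.cong refl arg_cong2[where f = "(*)"]) (auto simp: z_def subset_iff)
    ultimately show "sl_form E W y \<le> sl_form E W x" by simp
  qed
qed

lemma sl_index_attained:
  assumes "finite W" "W \<noteq> {}"
  obtains x :: "'a \<Rightarrow> real" where "(\<Sum>u\<in>W. (x u)\<^sup>2) = 1" "sl_form E W x = sl_index E W"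
    "\<And>y :: 'a \<Rightarrow> real. (\<Sum>u\<in>W. (y u)\<^sup>2) = 1 \<Longrightarrow> sl_form E W y \<le> sl_index E W"
proof -
  obtain x :: "'a \<Rightarrow> real" where x: "(\<Sum>u\<in>W. (x u)\<^sup>2) = 1"
    "\<And>y :: 'a \<Rightarrow> real. (\<Sum>u\<in>W. (y u)\<^sup>2) = 1 \<Longrightarrow> sl_form E W y \<le> sl_form E W x"
    using sl_form_attains_sup[OF assms] by metis
  have "sl_index E W = sl_form E W x"
    unfolding sl_index_def using x by (intro cSup_eq_maximum) auto
  with x that show ?thesis by metis
qed

lemma sl_form_le_sl_index:
  fixes y :: "'a \<Rightarrow> real"
  assumes "finite W" "W \<noteq> {}"
  shows "sl_form E W y \<le> sl_index E W * (\<Sum>u\<in>W. (y u)\<^sup>2)"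
proof (cases "(\<Sum>u\<in>W. (y u)\<^sup>2) = 0")
  case True
  then have "y u = 0" if "u \<in> W" for u
    using that assms by (simp add: sum_nonneg_eq_0_iff)
  then have "sl_form E W y = 0" by (simp add: sl_form_def)
  with True show ?thesis by simp
next
  case False
  define s where "s = (\<Sum>u\<in>W. (y u)\<^sup>2)"
  have s: "s > 0" using False by (simp add: s_def sum_nonneg less_le)
  define c where "c = 1 / sqrt s"
  have c2: "c\<^sup>2 * s = 1" using s by (simp add: c_def power_divide)
  have "(\<Sum>u\<in>W. (c * y u)\<^sup>2) = c\<^sup>2 * s"
    by (simp add: s_def power_mult_distrib sum_distrib_left)
  then have "sl_form E W (\<lambda>u. c * y u) \<le> sl_index E W"
    using c2 sl_index_attained[OF assms, of E] by metis
  then have "c\<^sup>2 * sl_form E W y \<le> sl_index E W" by (simp add: sl_form_scale)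
  then have "s * (c\<^sup>2 * sl_form E W y) \<le> s * sl_index E W" using s by (simp add: mult_left_mono)
  moreover have "s * (c\<^sup>2 * sl_form E W y) = (c\<^sup>2 * s) * sl_form E W y" by simp
  ultimately have "sl_form E W y \<le> s * sl_index E W" unfolding c2 by simp
  then show ?thesis by (simp add: s_def mult.commute)
qed

lemma linear_coeff_zero:
  fixes b c :: real
  assumes "\<And>t. 2 * t * b + t\<^sup>2 * c \<le> 0"
  shows "b = 0"
proof (rule ccontr)
  assume b: "b \<noteq> 0"
  \<comment> \<open>For small \<open>t\<close> with the sign of \<open>b\<close> the linear term dominates.\<close>
  define t where "t = b / (\<bar>c\<bar> + 1)"
  have t: "t * (\<bar>c\<bar> + 1) = b" by (simp add: t_def field_simps)
  have "2 * t * b + t\<^sup>2 * c = t\<^sup>2 * (2 * \<bar>c\<bar> + 2 + c)"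
    unfolding t[symmetric] by (simp add: power2_eq_square algebra_simps)
  moreover have "t\<^sup>2 * (2 * \<bar>c\<bar> + 2 + c) > 0"
    using b by (intro mult_pos_pos) (auto simp: t_def)
  ultimately show False using assms[of t] by simp
qed

text \<open>
  Replacing a maximizer by its absolute value does not decrease the form, so there is a nonnegative
  maximizer. It is an eigenvector by the first-order condition in each coordinate direction.
\<close>

lemma sl_index_perron:
  assumes "finite W" "W \<noteq> {}" "sym E" "irrefl E"
  obtains x :: "'a \<Rightarrow> real" where "\<And>u. x u \<ge> 0" "(\<Sum>u\<in>W. (x u)\<^sup>2) = 1"
    "\<And>u. u \<in> W \<Longrightarrow> sl_apply E W x u = sl_index E W * x u"
proof -
  let ?q = "sl_index E W"
  obtain z :: "'a \<Rightarrow> real" where z: "(\<Sum>u\<in>W. (z u)\<^sup>2) = 1" "sl_form E W z = ?q"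
    "\<And>y :: 'a \<Rightarrow> real. (\<Sum>u\<in>W. (y u)\<^sup>2) = 1 \<Longrightarrow> sl_form E W y \<le> ?q"
    using sl_index_attained[OF assms(1,2)] by metis
  define x where "x = (\<lambda>u. \<bar>z u\<bar>)"
  have x1: "(\<Sum>u\<in>W. (x u)\<^sup>2) = 1" using z(1) by (simp add: x_def)
  have xq: "sl_form E W x = ?q"
    using z(2) z(3)[OF x1] sl_form_abs_ge[of E W z] by (simp add: x_def)
  have "sl_apply E W x u = ?q * x u" if u: "u \<in> W" for u
  proof -
    have "2 * t * (sl_apply E W x u - ?q * x u) + t\<^sup>2 * (card (nbrs E W u) - ?q) \<le> 0" for t
    proof -
      have "(\<Sum>w\<in>W. ((x(u := x u + t)) w)\<^sup>2) = (x u + t)\<^sup>2 + (\<Sum>w\<in>W - {u}. (x w)\<^sup>2)"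
        using u assms(1) by (simp add: sum.remove)
      also have "\<dots> = (\<Sum>w\<in>W. (x w)\<^sup>2) + 2 * t * x u + t\<^sup>2"
        using u assms(1) by (simp add: sum.remove power2_eq_square algebra_simps)
      finally have n: "(\<Sum>w\<in>W. ((x(u := x u + t)) w)\<^sup>2) = 1 + 2 * t * x u + t\<^sup>2" using x1 by simp
      have "(u, u) \<notin> E" using assms(4) by (auto simp: irrefl_def)
      from sl_form_perturb[OF assms(1,3) u this, of x t] sl_form_le_sl_index[OF assms(1,2), of E "x(u := x u + t)"]
      have "?q + 2 * t * sl_apply E W x u + t\<^sup>2 * card (nbrs E W u) \<le> ?q * (1 + 2 * t * x u + t\<^sup>2)"
        unfolding n xq by simp
      then show ?thesis by (simp add: algebra_simps)
    qed
    then have "sl_apply E W x u - ?q * x u = 0" by (rule linear_coeff_zero)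
    then show ?thesis by simp
  qed
  then show ?thesis using that[of x] x1 by (auto simp: x_def)
qed

lemma sl_index_le_twice_card:
  assumes "finite W" "W \<noteq> {}" "sym E"
  shows "sl_index E W \<le> 2 * card W"
proof -
  obtain x :: "'a \<Rightarrow> real" where x: "(\<Sum>u\<in>W. (x u)\<^sup>2) = 1" "sl_form E W x = sl_index E W"
    using sl_index_attained[OF assms(1,2), of E] by blast
  have "sl_index E W \<le> 2 * (\<Sum>u\<in>W. card (nbrs E W u) * (x u)\<^sup>2)"
    using sl_form_le_degrees[OF assms(1,3), of x] unfolding x(2) .
  also have "\<dots> \<le> 2 * (\<Sum>u\<in>W. card W * (x u)\<^sup>2)"
    using card_nbrs_le[OF assms(1)] by (intro mult_left_mono sum_mono mult_right_mono) auto
  also have "\<dots> = 2 * card W" using x(1) by (simp add: sum_distrib_left[symmetric])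
  finally show ?thesis .
qed

text \<open>
  Setting the entry of \<open>v\<close> to zero is a perturbation in the direction of \<open>v\<close>. It leaves the form of
  the graph without \<open>v\<close>, apart from the squares on the edges at \<open>v\<close>.
\<close>

lemma sl_form_delete_vertex:
  fixes x :: "'a \<Rightarrow> real"
  assumes "finite W" "sym E" "irrefl E" "v \<in> W" "\<And>u. u \<in> W \<Longrightarrow> sl_apply E W x u = q * x u"
  shows "sl_form E (W - {v}) x = q * (\<Sum>u\<in>W. (x u)\<^sup>2) - (2 * q - card (nbrs E W v)) * (x v)\<^sup>2
           - (\<Sum>w\<in>nbrs E W v. (x w)\<^sup>2)"
proof -
  define y where "y = x(v := x v + (- x v))"
  have vv: "(v, v) \<notin> E" using assms(3) by (auto simp: irrefl_def)
  have "sl_form E W x = q * (\<Sum>u\<in>W. (x u)\<^sup>2)"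
    by (simp add: sl_form_def assms(5) sum_distrib_left power2_eq_square algebra_simps)
  then have 1: "sl_form E W y = q * (\<Sum>u\<in>W. (x u)\<^sup>2) - (2 * q - card (nbrs E W v)) * (x v)\<^sup>2"
    unfolding y_def sl_form_perturb[OF assms(1,2,4) vv]
    using assms(5)[OF assms(4)] by (simp add: algebra_simps power2_eq_square)
  have ap: "sl_apply E W y u = sl_apply E (W - {v}) x u + (if (u, v) \<in> E then x u else 0)"
    if "u \<in> W - {v}" for u
  proof -
    have "nbrs E (W - {v}) u = nbrs E W u - {v}" by (auto simp: nbrs_def)
    moreover have "(\<Sum>w\<in>nbrs E W u. y u + y w) = (\<Sum>w\<in>nbrs E W u - {v}. y u + y w) + (if (u, v) \<in> E then y u + y v else 0)"
    proof (cases "(u, v) \<in> E")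
      case True
      then have "v \<in> nbrs E W u" using assms(4) by (simp add: nbrs_def)
      then show ?thesis using True assms(1)
        sum.remove[of "nbrs E W u" v "\<lambda>w. y u + y w"] by (simp only: finite_nbrs if_True add.commute)
    next
      case False
      then have "nbrs E W u - {v} = nbrs E W u" by (auto simp: nbrs_def)
      then show ?thesis using False by simp
    qed
    moreover have "(\<Sum>w\<in>nbrs E W u - {v}. y u + y w) = (\<Sum>w\<in>nbrs E W u - {v}. x u + x w)"
      using that by (intro sum.cong) (auto simp: y_def)
    ultimately show ?thesis using that by (simp add: sl_apply_def y_def)
  qed
  have "sl_form E W y = (\<Sum>u\<in>W - {v}. y u * sl_apply E W y u)"
    unfolding sl_form_def using assms(1,4) by (subst sum.remove[of _ v]) (auto simp: y_def)
  also have "\<dots> = (\<Sum>u\<in>W - {v}. x u * sl_apply E (W - {v}) x u + (if (u, v) \<in> E then (x u)\<^sup>2 else 0))"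
    by (intro sum.cong refl, subst ap) (auto simp: y_def algebra_simps power2_eq_square)
  also have "\<dots> = sl_form E (W - {v}) x + (\<Sum>u\<in>W - {v}. if (u, v) \<in> E then (x u)\<^sup>2 else 0)"
    by (simp add: sum.distrib sl_form_def)
  also have "(\<Sum>u\<in>W - {v}. if (u, v) \<in> E then (x u)\<^sup>2 else 0) = (\<Sum>u\<in>{u \<in> W - {v}. (u, v) \<in> E}. (x u)\<^sup>2)"
    by (rule sum.inter_filter[symmetric]) (use assms(1) in simp)
  also have "{u \<in> W - {v}. (u, v) \<in> E} = nbrs E W v"
    using assms(2) vv by (auto simp: nbrs_def dest: symD)
  finally show ?thesis using 1 by simp
qed

section \<open>Dense book-free graphs are multipartite\<close>

definition common_nbrs :: "'a rel \<Rightarrow> 'a set \<Rightarrow> 'a set \<Rightarrow> 'a set" where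
  "common_nbrs E W S = {w \<in> W. \<forall>s\<in>S. (s, w) \<in> E}"

definition clique :: "'a rel \<Rightarrow> 'a set \<Rightarrow> bool" where
  "clique E S \<longleftrightarrow> (\<forall>u\<in>S. \<forall>v\<in>S. u \<noteq> v \<longrightarrow> (u, v) \<in> E)"

text \<open>
  The condition that an \<open>r\<close>-clique never has \<open>k\<close> common neighbours, i.e. freeness from generalized
  books, in the form in which it is applied.
\<close>

definition book_free :: "'a rel \<Rightarrow> 'a set \<Rightarrow> nat \<Rightarrow> nat \<Rightarrow> bool" where
  "book_free E W r k \<longleftrightarrow>
     (\<forall>S. S \<subseteq> W \<longrightarrow> card S = r \<longrightarrow> clique E S \<longrightarrow> card (common_nbrs E W S) < k)"

lemma book_free_mono:
  assumes "book_free E W r k" "V \<subseteq> W" "finite W"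
  shows "book_free E V r k"
  unfolding book_free_def
proof (intro allI impI)
  fix S assume S: "S \<subseteq> V" "card S = r" "clique E S"
  have "common_nbrs E V S \<subseteq> common_nbrs E W S" using assms(2) by (auto simp: common_nbrs_def)
  moreover have "finite (common_nbrs E W S)" using assms(3) by (simp add: common_nbrs_def)
  ultimately have "card (common_nbrs E V S) \<le> card (common_nbrs E W S)" by (rule card_mono[rotated])
  also have "\<dots> < k" using assms S unfolding book_free_def by blast
  finally show "card (common_nbrs E V S) < k" .
qed

lemma common_nbrs_subset: "common_nbrs E W S \<subseteq> W"
  by (auto simp: common_nbrs_def)

lemma clique_insert:
  assumes "sym E" "clique E S" "\<forall>s\<in>S. (s, w) \<in> E"
  shows "clique E (insert w S)"
  using assms by (auto simp: clique_def dest: symD)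

text \<open>
  Each vertex has at most \<open>h/r + h/(64r\<^sup>3)\<close> non-neighbours, where \<open>h\<close> is the number of vertices. The
  factor \<open>1/r\<^sup>3\<close> leaves room for up to \<open>r\<close> greedy choices, each of which may lose \<open>O(r)\<close> error
  terms, inside classes of size \<open>h/r\<close>.
\<close>

locale dense_book_free =
  fixes E :: "'a rel" and W :: "'a set" and r k :: nat
  assumes finite_W: "finite W" and sym_E: "sym E" and irrefl_E: "irrefl E"
    and r_ge_2: "r \<ge> 2" and W_nonempty: "W \<noteq> {}"
    and free: "book_free E W r k"
    and large: "64 * real r ^ 3 * real k \<le> real (card W)"
    and dense: "\<And>u. u \<in> W \<Longrightarrow>
      real (card W) - real (card (nbrs E W u)) \<le> real (card W) / real r + real (card W) / (64 * real r ^ 3)"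
begin

text \<open>
  The unit in which all errors are counted: \<open>h = 64 r\<^sup>3 eps\<close> and \<open>h/r = 64 r\<^sup>2 eps\<close>, so that
  every estimate becomes linear in \<open>eps\<close>, \<open>r eps\<close> and \<open>r\<^sup>2 eps\<close>.
\<close>

definition eps :: real where "eps = real (card W) / (64 * real r ^ 3)"

lemma eps_pos: "eps > 0"
  using finite_W W_nonempty r_ge_2 by (simp add: eps_def card_gt_0_iff)

lemma k_le_eps: "real k \<le> eps"
  using large r_ge_2 by (simp add: eps_def field_simps)

lemma card_W: "real (card W) = 64 * real r ^ 3 * eps"
  using r_ge_2 by (simp add: eps_def)

lemma real_r_ge_2: "real r \<ge> 2"
  using r_ge_2 by simp

lemma r_eps: "2 * eps \<le> real r * eps" "2 * (real r * eps) \<le> (real r)\<^sup>2 * eps"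
  using real_r_ge_2 eps_pos by (simp_all add: power2_eq_square mult_right_mono)

lemma finite_sub: "A \<subseteq> W \<Longrightarrow> finite A"
  using finite_W finite_subset by blast

lemma finite_common: "finite (common_nbrs E W S)"
  by (intro finite_sub common_nbrs_subset)

lemma not_refl: "(u, u) \<notin> E"
  using irrefl_E by (simp add: irrefl_def)

lemma card_non_nbrs:
  assumes "u \<in> W"
  shows "real (card (W - nbrs E W u)) \<le> 64 * (real r)\<^sup>2 * eps + eps"
proof -
  have "card (W - nbrs E W u) = card W - card (nbrs E W u)"
    by (intro card_Diff_subset finite_nbrs finite_W nbrs_subset)
  moreover have "card (nbrs E W u) \<le> card W" by (rule card_nbrs_le[OF finite_W])
  ultimately have "real (card (W - nbrs E W u)) = real (card W) - real (card (nbrs E W u))"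
    by simp
  also have "\<dots> \<le> real (card W) / real r + eps" using dense[OF assms] by (simp add: eps_def)
  also have "real (card W) / real r = 64 * (real r)\<^sup>2 * eps"
    unfolding card_W using r_ge_2 by (simp add: power2_eq_square power3_eq_cube)
  finally show ?thesis .
qed

lemma card_common_nbrs_ge:
  assumes "S \<subseteq> W"
  shows "real (card W) - real (card S) * (64 * (real r)\<^sup>2 * eps + eps)
    \<le> real (card (common_nbrs E W S))"
proof -
  have fS: "finite S" using assms by (rule finite_sub)
  have eq: "W - common_nbrs E W S = (\<Union>s\<in>S. W - nbrs E W s)"
    by (auto simp: common_nbrs_def nbrs_def)
  have "card (W - common_nbrs E W S) \<le> (\<Sum>s\<in>S. card (W - nbrs E W s))"
    unfolding eq by (rule card_UN_le[OF fS])
  then have "real (card (W - common_nbrs E W S)) \<le> (\<Sum>s\<in>S. real (card (W - nbrs E W s)))"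
    by (metis of_nat_le_iff of_nat_sum)
  also have "\<dots> \<le> (\<Sum>s\<in>S. 64 * (real r)\<^sup>2 * eps + eps)"
    using assms by (intro sum_mono card_non_nbrs) auto
  also have "\<dots> = real (card S) * (64 * (real r)\<^sup>2 * eps + eps)" by simp
  finally have 1: "real (card (W - common_nbrs E W S)) \<le> real (card S) * (64 * (real r)\<^sup>2 * eps + eps)" .
  have "card (W - common_nbrs E W S) = card W - card (common_nbrs E W S)"
    by (intro card_Diff_subset finite_common common_nbrs_subset)
  moreover have "card (common_nbrs E W S) \<le> card W"
    by (intro card_mono finite_W common_nbrs_subset)
  ultimately have "real (card (W - common_nbrs E W S)) = real (card W) - real (card (common_nbrs E W S))"
    by simp
  with 1 show ?thesis by linarith
qed

lemma card_common_nbrs_ge':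
  assumes "S \<subseteq> W" "card S \<le> r - 1"
  shows "64 * (real r)\<^sup>2 * eps - (real r - 1) * eps \<le> real (card (common_nbrs E W S))"
proof -
  have "real (card S) \<le> real r - 1" using assms(2) r_ge_2 by (simp add: of_nat_diff)
  then have "real (card S) * (64 * (real r)\<^sup>2 * eps + eps) \<le> (real r - 1) * (64 * (real r)\<^sup>2 * eps + eps)"
    using eps_pos by (intro mult_right_mono) auto
  then have "64 * real r ^ 3 * eps - (real r - 1) * (64 * (real r)\<^sup>2 * eps + eps) \<le> real (card (common_nbrs E W S))"
    using card_common_nbrs_ge[OF assms(1)] unfolding card_W by linarith
  then show ?thesis by (simp add: algebra_simps power2_eq_square power3_eq_cube)
qed

lemma clique_exists: "s \<le> r \<Longrightarrow> \<exists>S\<subseteq>W. card S = s \<and> clique E S"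
proof (induction s)
  case 0
  show ?case by (intro exI[of _ "{}"]) (simp add: clique_def)
next
  case (Suc s)
  then obtain S where S: "S \<subseteq> W" "card S = s" "clique E S" by auto
  have "64 * (real r)\<^sup>2 * eps - (real r - 1) * eps \<le> real (card (common_nbrs E W S))"
    using S(2) Suc.prems by (intro card_common_nbrs_ge' S(1)) simp
  then have "real (card (common_nbrs E W S)) > 0"
    using r_eps eps_pos unfolding left_diff_distrib by linarith
  then have "common_nbrs E W S \<noteq> {}" by auto
  then obtain w where w: "w \<in> W" "\<forall>s\<in>S. (s, w) \<in> E" by (auto simp: common_nbrs_def)
  have "w \<notin> S" using w(2) not_refl by auto
  then have "card (insert w S) = Suc s" using S finite_sub by simp
  moreover have "clique E (insert w S)" using clique_insert[OF sym_E S(3) w(2)] .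
  ultimately show ?case using S(1) w(1) by (intro exI[of _ "insert w S"]) auto
qed

definition base :: "'a set" where
  "base = (SOME K. K \<subseteq> W \<and> card K = r \<and> clique E K)"

lemma base: "base \<subseteq> W" "card base = r" "clique E base"
  using someI_ex[OF clique_exists[of r]] unfolding base_def by auto

lemma finite_base: "finite base"
  using base(1) by (rule finite_sub)

text \<open>
  The approximate colour classes: in the Turan graph, where the base clique has one vertex in each
  part, this is exactly the part of \<open>v\<close>.
\<close>

definition miss_class :: "'a \<Rightarrow> 'a set" where
  "miss_class v = common_nbrs E W (base - {v})"

lemma miss_class_subset: "miss_class v \<subseteq> W"
  by (simp add: miss_class_def common_nbrs_subset)

lemma finite_miss_class: "finite (miss_class v)"
  by (rule finite_sub[OF miss_class_subset])

lemma card_miss_class_ge: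
  assumes "v \<in> base"
  shows "64 * (real r)\<^sup>2 * eps - (real r - 1) * eps \<le> real (card (miss_class v))"
  unfolding miss_class_def using base finite_base assms
  by (intro card_common_nbrs_ge') (auto simp: card_Diff_singleton)

text \<open>
  Replacing \<open>v\<close> by \<open>w\<close> in the base clique gives another \<open>r\<close>-clique, whose common neighbours are the
  neighbours of \<open>w\<close> in the class of \<open>v\<close>.
\<close>

lemma card_nbrs_in_own_class:
  assumes "v \<in> base" "w \<in> miss_class v"
  shows "real (card (nbrs E W w \<inter> miss_class v)) \<le> eps"
proof -
  let ?K = "insert w (base - {v})"
  have w: "w \<in> W" "\<forall>s\<in>base - {v}. (s, w) \<in> E" using assms(2) by (auto simp: miss_class_def common_nbrs_def)
  have "clique E ?K"
    using base(3) w(2) by (intro clique_insert sym_E) (auto simp: clique_def)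
  moreover have "w \<notin> base - {v}" using w(2) not_refl by auto
  then have "card ?K = r" using base(2) finite_base assms(1) r_ge_2 by (simp add: card_Diff_singleton)
  moreover have "?K \<subseteq> W" using w(1) base(1) by auto
  ultimately have "card (common_nbrs E W ?K) < k" using free unfolding book_free_def by blast
  moreover have "common_nbrs E W ?K = nbrs E W w \<inter> miss_class v"
    by (auto simp: common_nbrs_def miss_class_def nbrs_def)
  ultimately show ?thesis using k_le_eps by simp
qed

text \<open>
  A class has about \<open>h/r\<close> vertices, which is also about the number of non-neighbours of \<open>w\<close>. If \<open>w\<close>
  has few neighbours in one class, its non-neighbours are used up there, and since the classes are
  almost disjoint few are left for any other class.
\<close>

lemma card_non_nbrs_in_other_class:
  assumes "v \<in> base" "l \<in> base" "l \<noteq> v" "w \<in> W" "real (card (nbrs E W w \<inter> miss_class v)) \<le> t"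
  shows "real (card (miss_class l - nbrs E W w)) \<le> (real r + 1) * eps + t"
proof -
  let ?A = "miss_class l - nbrs E W w" and ?B = "miss_class v - nbrs E W w"
  have fin: "finite ?A" "finite ?B" using finite_miss_class by auto
  have "miss_class l \<inter> miss_class v = common_nbrs E W base"
    using assms(3) by (auto simp: miss_class_def common_nbrs_def)
  then have "card (miss_class l \<inter> miss_class v) < k" using free base unfolding book_free_def by simp
  moreover have "card (?A \<inter> ?B) \<le> card (miss_class l \<inter> miss_class v)" using finite_miss_class by (intro card_mono) auto
  ultimately have 1: "real (card (?A \<inter> ?B)) \<le> eps" using k_le_eps by simp
  have "card (?A \<union> ?B) \<le> card (W - nbrs E W w)"
    using miss_class_subset finite_W by (intro card_mono) auto
  then have 2: "real (card (?A \<union> ?B)) \<le> 64 * (real r)\<^sup>2 * eps + eps"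
    using card_non_nbrs[OF assms(4)] by simp
  have 3: "real (card ?A) + real (card ?B) = real (card (?A \<union> ?B)) + real (card (?A \<inter> ?B))"
    using card_Un_Int[OF fin] by (simp flip: of_nat_add)
  have "card (miss_class v) = card ?B + card (nbrs E W w \<inter> miss_class v)"
    using card_Int_Diff[OF finite_miss_class, of v "nbrs E W w"] by (simp add: Int_commute)
  then have 4: "64 * (real r)\<^sup>2 * eps - (real r - 1) * eps \<le> real (card ?B) + t"
    using card_miss_class_ge[OF assms(1)] assms(5) by simp
  show ?thesis using 1 2 3 4 by (simp add: algebra_simps)
qed

text \<open>
  A vertex picked from one class is adjacent to all but \<open>2r eps\<close> vertices of every other class.
  Vertices can therefore be picked one after the other, shrinking the candidate sets \<open>D\<close> to
  neighbours of the last choice.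
\<close>

lemma greedy_clique:
  assumes "finite J" "J \<subseteq> base" "l \<in> base" "l \<notin> J"
    and "\<And>j. j \<in> insert l J \<Longrightarrow> D j \<subseteq> miss_class j"
    and "\<And>j. j \<in> J \<Longrightarrow> real (card J) * (2 * real r * eps) < real (card (D j))"
    and "real (card J) * (2 * real r * eps) + real k \<le> real (card (D l))"
  shows "\<exists>U. U \<subseteq> (\<Union>j\<in>J. D j) \<and> card U = card J \<and> clique E U \<and>
    k \<le> card {x \<in> D l. \<forall>u\<in>U. (u, x) \<in> E}"
  using assms
proof (induction J arbitrary: D rule: finite_induct)
  case empty
  then show ?case by (intro exI[of _ "{}"]) (auto simp: clique_def)
next
  case (insert j J)
  have cJ: "real (card (insert j J)) = real (card J) + 1" using insert.hyps by simp
  have "0 < real (card (D j))"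
    using insert.prems(5)[of j] eps_pos by (smt (verit) insertI1 mult_nonneg_nonneg of_nat_0_le_iff)
  then have "D j \<noteq> {}" by auto
  then obtain u where u: "u \<in> D j" by auto
  have u_class: "u \<in> miss_class j" using u insert.prems(4)[of j] by auto
  then have uW: "u \<in> W" using miss_class_subset by auto
  have jb: "j \<in> base" using insert.prems(1) by auto
  define D' where "D' i = D i \<inter> nbrs E W u" for i
  have cD': "real (card (D i)) - 2 * real r * eps \<le> real (card (D' i))" if i: "i \<in> insert l J" for i
  proof -
    have "i \<noteq> j" "i \<in> base" "D i \<subseteq> miss_class i" using i insert.hyps insert.prems by auto
    have "real (card (miss_class i - nbrs E W u)) \<le> (real r + 1) * eps + eps"
      using card_non_nbrs_in_other_class[OF jb \<open>i \<in> base\<close> \<open>i \<noteq> j\<close> uW card_nbrs_in_own_class[OF jb u_class]] .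
    moreover have "card (D i - nbrs E W u) \<le> card (miss_class i - nbrs E W u)"
      using \<open>D i \<subseteq> miss_class i\<close> finite_miss_class by (intro card_mono) auto
    moreover have "finite (D i)" using \<open>D i \<subseteq> miss_class i\<close> finite_miss_class finite_subset by blast
    then have "card (D i) = card (D' i) + card (D i - nbrs E W u)"
      unfolding D'_def by (rule card_Int_Diff)
    ultimately show ?thesis using r_eps by (simp add: algebra_simps)
  qed
  have "\<exists>U. U \<subseteq> (\<Union>j\<in>J. D' j) \<and> card U = card J \<and> clique E U \<and>
    k \<le> card {x \<in> D' l. \<forall>u\<in>U. (u, x) \<in> E}"
  proof (rule insert.IH)
    fix i assume "i \<in> insert l J"
    then show "D' i \<subseteq> miss_class i" using insert.prems(4)[of i] by (auto simp: D'_def)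
  next
    fix i assume i: "i \<in> J"
    show "real (card J) * (2 * real r * eps) < real (card (D' i))"
      using insert.prems(5)[of i] cD'[of i] i unfolding cJ by (simp add: algebra_simps)
  next
    show "real (card J) * (2 * real r * eps) + real k \<le> real (card (D' l))"
      using insert.prems(6) cD'[of l] unfolding cJ by (simp add: algebra_simps)
  qed (use insert.prems in auto)
  then obtain U where U: "U \<subseteq> (\<Union>j\<in>J. D' j)" "card U = card J" "clique E U"
    "k \<le> card {x \<in> D' l. \<forall>u\<in>U. (u, x) \<in> E}" by auto
  have Uu: "U \<subseteq> nbrs E W u" using U(1) by (auto simp: D'_def)
  have "u \<notin> U" using Uu not_refl by (auto simp: nbrs_def)
  moreover have "finite U" by (rule finite_subset[OF Uu]) (simp add: finite_W)
  ultimately have "card (insert u U) = card (insert j J)" using U(2) insert.hyps by simp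
  moreover have "(s, u) \<in> E" if "s \<in> U" for s
    using Uu that symD[OF sym_E, of u s] by (auto simp: nbrs_def)
  then have "clique E (insert u U)"
    by (intro clique_insert sym_E U(3)) blast
  moreover have "insert u U \<subseteq> (\<Union>i\<in>insert j J. D i)" using U(1) u by (auto simp: D'_def)
  moreover have "{x \<in> D' l. \<forall>u\<in>U. (u, x) \<in> E} = {x \<in> D l. \<forall>v\<in>insert u U. (v, x) \<in> E}"
    using insert.prems(4)[of l] miss_class_subset by (auto simp: D'_def nbrs_def)
  ultimately show ?case using U(4) by (intro exI[of _ "insert u U"]) simp
qed

text \<open>
  If a clique \<open>S\<close> has many common neighbours in \<open>r - |S| + 1\<close> classes, then one vertex from all but one
  of them completes \<open>S\<close> to an \<open>r\<close>-clique, and the last class supplies \<open>k\<close> common neighbours.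
\<close>

lemma no_extendable_clique:
  assumes "S \<subseteq> W" "clique E S" "J \<subseteq> base" "l \<in> base - J" "card S + card J = r"
    and "\<And>j. j \<in> insert l J \<Longrightarrow> 8 * (real r)\<^sup>2 * eps \<le> real (card (miss_class j \<inter> common_nbrs E W S))"
  shows False
proof -
  define D where "D j = miss_class j \<inter> common_nbrs E W S" for j
  have fJ: "finite J" using assms(3) finite_base finite_subset by blast
  have "real (card J) * (2 * real r * eps) \<le> real r * (2 * real r * eps)"
    using assms(5) eps_pos by (intro mult_right_mono) auto
  then have J: "real (card J) * (2 * real r * eps) \<le> 2 * (real r)\<^sup>2 * eps"
    by (simp add: power2_eq_square)
  have "\<exists>U. U \<subseteq> (\<Union>j\<in>J. D j) \<and> card U = card J \<and> clique E U \<and>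
    k \<le> card {x \<in> D l. \<forall>u\<in>U. (u, x) \<in> E}"
  proof (rule greedy_clique[OF fJ assms(3)])
    show "real (card J) * (2 * real r * eps) < real (card (D j))" if "j \<in> J" for j
      using assms(6)[of j] that J r_eps eps_pos unfolding D_def by (simp; linarith)
    show "real (card J) * (2 * real r * eps) + real k \<le> real (card (D l))"
      using assms(6)[of l] J r_eps k_le_eps eps_pos unfolding D_def by (simp; linarith)
  qed (use assms in \<open>auto simp: D_def\<close>)
  then obtain U where U: "U \<subseteq> (\<Union>j\<in>J. D j)" "card U = card J" "clique E U"
    "k \<le> card {x \<in> D l. \<forall>u\<in>U. (u, x) \<in> E}" by auto
  have US: "U \<subseteq> common_nbrs E W S" using U(1) by (auto simp: D_def)
  have "S \<inter> U = {}" using US not_refl by (auto simp: common_nbrs_def)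
  moreover have "finite S" using assms(1) by (rule finite_sub)
  moreover have "finite U" using US finite_common finite_subset by blast
  ultimately have "card (S \<union> U) = r" using assms(5) U(2) by (simp add: card_Un_disjoint)
  moreover have su: "(s, u) \<in> E" if "s \<in> S" "u \<in> U" for s u
    using US that by (auto simp: common_nbrs_def)
  then have "clique E (S \<union> U)"
    using assms(2) U(3) symD[OF sym_E] unfolding clique_def by blast
  moreover have "S \<union> U \<subseteq> W" using assms(1) US common_nbrs_subset[of E W S] by blast
  ultimately have "card (common_nbrs E W (S \<union> U)) < k" using free unfolding book_free_def by blast
  moreover have "{x \<in> D l. \<forall>u\<in>U. (u, x) \<in> E} \<subseteq> common_nbrs E W (S \<union> U)"
    by (auto simp: D_def common_nbrs_def)
  then have "card {x \<in> D l. \<forall>u\<in>U. (u, x) \<in> E} \<le> card (common_nbrs E W (S \<union> U))"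
    by (rule card_mono[OF finite_common])
  ultimately show False using U(4) by simp
qed

text \<open>
  Otherwise the single vertex \<open>w\<close> is extendable.
\<close>

lemma sparse_class_exists:
  assumes "w \<in> W"
  shows "\<exists>v\<in>base. real (card (nbrs E W w \<inter> miss_class v)) \<le> 8 * (real r)\<^sup>2 * eps"
proof (rule ccontr)
  assume no: "\<not> ?thesis"
  have "base \<noteq> {}" using base(2) r_ge_2 by auto
  then obtain l where l: "l \<in> base" by auto
  have cn: "miss_class j \<inter> common_nbrs E W {w} = nbrs E W w \<inter> miss_class j" for j
    by (auto simp: common_nbrs_def nbrs_def)
  show False
  proof (rule no_extendable_clique[of "{w}" "base - {l}" l])
    show "card {w} + card (base - {l}) = r"
      using l base(2) finite_base r_ge_2 by (simp add: card_Diff_singleton)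
    fix j assume "j \<in> insert l (base - {l})"
    then have "j \<in> base" using l by auto
    then show "8 * (real r)\<^sup>2 * eps \<le> real (card (miss_class j \<inter> common_nbrs E W {w}))"
      unfolding cn using no linear by blast
  qed (use l assms in \<open>auto simp: clique_def\<close>)
qed

text \<open>
  Otherwise the edge between \<open>u\<close> and \<open>w\<close> is extendable: both vertices are adjacent to almost
  everything in the \<open>r - 1\<close> classes other than the \<open>i\<close>-th.
\<close>

lemma sparse_to_same_class_imp_nonadjacent:
  assumes "u \<in> W" "w \<in> W" "i \<in> base"
    and "real (card (nbrs E W u \<inter> miss_class i)) \<le> 8 * (real r)\<^sup>2 * eps"
    and "real (card (nbrs E W w \<inter> miss_class i)) \<le> 8 * (real r)\<^sup>2 * eps"
  shows "(u, w) \<notin> E"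
proof
  assume uw: "(u, w) \<in> E"
  have "card (base - {i}) = r - 1" using assms(3) base(2) finite_base by simp
  then have "card (base - {i}) \<noteq> 0" using r_ge_2 by simp
  then have "base - {i} \<noteq> {}" by (metis card.empty)
  then obtain l where l: "l \<in> base" "l \<noteq> i" by auto
  have neq: "u \<noteq> w" using uw not_refl by auto
  show False
  proof (rule no_extendable_clique[of "{u, w}" "base - {i, l}" l])
    show "clique E {u, w}" using uw symD[OF sym_E uw] by (auto simp: clique_def)
    have "card (base - {i, l}) = card base - card {i, l}"
      using l assms(3) by (intro card_Diff_subset) auto
    then show "card {u, w} + card (base - {i, l}) = r"
      using l neq base(2) r_ge_2 by simp
    fix j assume "j \<in> insert l (base - {i, l})"
    then have j: "j \<in> base" "j \<noteq> i" using l by auto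
    have mu: "real (card (miss_class j - nbrs E W u)) \<le> (real r + 1) * eps + 8 * (real r)\<^sup>2 * eps"
      by (rule card_non_nbrs_in_other_class[OF assms(3) j assms(1,4)])
    have mw: "real (card (miss_class j - nbrs E W w)) \<le> (real r + 1) * eps + 8 * (real r)\<^sup>2 * eps"
      by (rule card_non_nbrs_in_other_class[OF assms(3) j assms(2,5)])
    have "miss_class j \<subseteq> (miss_class j \<inter> common_nbrs E W {u, w}) \<union> ((miss_class j - nbrs E W u) \<union> (miss_class j - nbrs E W w))"
      using miss_class_subset by (auto simp: common_nbrs_def nbrs_def)
    then have "card (miss_class j) \<le> card ((miss_class j \<inter> common_nbrs E W {u, w}) \<union> ((miss_class j - nbrs E W u) \<union> (miss_class j - nbrs E W w)))"
      using finite_miss_class by (intro card_mono) auto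
    also have "\<dots> \<le> card (miss_class j \<inter> common_nbrs E W {u, w}) + (card (miss_class j - nbrs E W u) + card (miss_class j - nbrs E W w))"
      by (meson add_left_mono card_Un_le le_trans)
    finally have "real (card (miss_class j)) \<le> real (card (miss_class j \<inter> common_nbrs E W {u, w}))
       + (real (card (miss_class j - nbrs E W u)) + real (card (miss_class j - nbrs E W w)))"
      by (simp flip: of_nat_add)
    then show "8 * (real r)\<^sup>2 * eps \<le> real (card (miss_class j \<inter> common_nbrs E W {u, w}))"
      using mu mw card_miss_class_ge[OF j(1)] r_eps eps_pos
      unfolding left_diff_distrib distrib_right by linarith
  qed (use l assms in auto)
qed

lemma colourable:
  "\<exists>c. c ` W \<subseteq> base \<and> (\<forall>u\<in>W. \<forall>w\<in>W. (u, w) \<in> E \<longrightarrow> c u \<noteq> c w)"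
proof -
  define c where
    "c w = (SOME v. v \<in> base \<and> real (card (nbrs E W w \<inter> miss_class v)) \<le> 8 * (real r)\<^sup>2 * eps)" for w
  have c: "c w \<in> base \<and> real (card (nbrs E W w \<inter> miss_class (c w))) \<le> 8 * (real r)\<^sup>2 * eps" if "w \<in> W" for w
    unfolding c_def by (rule someI_ex) (use sparse_class_exists[OF that] in blast)
  show ?thesis
  proof (intro exI[of _ c] conjI ballI impI notI)
    show "c ` W \<subseteq> base" using c by auto
    fix u w assume "u \<in> W" "w \<in> W" "(u, w) \<in> E" "c u = c w"
    then show False
      using c[of u] c[of w] sparse_to_same_class_imp_nonadjacent[of u w "c u"] by metis
  qed
qed

end

section \<open>Multipartite graphs and the Turan graph\<close>

text \<open>
  The gap between the function \<open>t / (c + 2t)\<close> and its chord through \<open>a\<close> and \<open>b\<close>. It is nonnegative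
  outside the interval from \<open>a\<close> to \<open>b\<close>, hence at every integer when \<open>b = a + 1\<close> with \<open>a\<close> an
  integer; for \<open>a = b\<close> the chord is the tangent.
\<close>

lemma chord_minus_fraction:
  fixes a b c t :: real
  assumes "c > 0" "a \<ge> 0" "b \<ge> 0" "t \<ge> 0"
  shows "a / (c + 2 * a) + c * (t - a) / ((c + 2 * a) * (c + 2 * b)) - t / (c + 2 * t)
       = 2 * c * (t - a) * (t - b) / ((c + 2 * a) * (c + 2 * b) * (c + 2 * t))"
proof -
  have "c + 2 * a \<noteq> 0" "c + 2 * b \<noteq> 0" "c + 2 * t \<noteq> 0" using assms by auto
  then show ?thesis by (simp add: divide_simps) (simp add: algebra_simps)
qed

lemma powr_le_tangent_at_one:
  fixes x p :: real
  assumes "x > 0" "0 \<le> p" "p \<le> 1"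
  shows "x powr p \<le> 1 - p + p * x"
  using Youngs_inequality_0[of p "1 - p" x 1] assms by simp

locale coloured_graph =
  fixes E :: "'a rel" and W :: "'a set" and K :: "'b set" and col :: "'a \<Rightarrow> 'b"
  assumes finite_W: "finite W" and W_nonempty: "W \<noteq> {}" and sym_E: "sym E" and irrefl_E: "irrefl E"
    and finite_K: "finite K" and col_K: "col ` W \<subseteq> K"
    and proper: "\<And>u w. u \<in> W \<Longrightarrow> w \<in> W \<Longrightarrow> (u, w) \<in> E \<Longrightarrow> col u \<noteq> col w"
begin

definition part :: "'b \<Rightarrow> 'a set" where "part i = {w \<in> W. col w = i}"

lemma finite_part: "finite (part i)" and part_subset: "part i \<subseteq> W"
  using finite_W by (auto simp: part_def)

lemma sum_over_parts:
  fixes f :: "'a \<Rightarrow> real"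
  shows "(\<Sum>i\<in>K. sum f (part i)) = sum f W"
  unfolding part_def by (rule sum.group[OF finite_W finite_K col_K])

lemma sum_card_parts: "(\<Sum>i\<in>K. real (card (part i))) = real (card W)"
  using sum_over_parts[of "\<lambda>_. 1"] by simp

lemma nbrs_other_parts:
  assumes "v \<in> W"
  shows "nbrs E W v \<subseteq> W - part (col v)"
  using proper[OF assms] by (fastforce simp: nbrs_def part_def)

lemma card_other_parts: "real (card (W - part i)) = real (card W) - real (card (part i))"
  using card_Diff_subset[OF finite_part part_subset, of i] card_mono[OF finite_W part_subset, of i]
  by (simp add: of_nat_diff)

text \<open>
  In the complete multipartite graph with these parts, a Perron vector is proportional to
  \<open>1 / (c + 2 n\<^sub>i)\<close> on a part of size \<open>n\<^sub>i\<close>, where \<open>c\<close> is the index minus the number of vertices, and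
  \<open>part_sum c = 1\<close> is its characteristic equation.
\<close>

definition part_sum :: "real \<Rightarrow> real" where
  "part_sum c = (\<Sum>i\<in>K. real (card (part i)) / (c + 2 * real (card (part i))))"

text \<open>
  The amount by which the eigenvector equation at \<open>v\<close> falls short of the one where \<open>v\<close> is adjacent to
  all vertices of the other parts.
\<close>

definition slack :: "('a \<Rightarrow> real) \<Rightarrow> real \<Rightarrow> 'a \<Rightarrow> real" where
  "slack x q v = (real (card W) - real (card (part (col v)))) * x v
      + (sum x W - sum x (part (col v))) - q * x v"

lemma missing_nbrs_le_slack:
  assumes "\<forall>u. x u \<ge> 0" "\<forall>u\<in>W. sl_apply E W x u = q * x u" "v \<in> W"
  shows "real (card (W - part (col v)) - card (nbrs E W v)) * x v \<le> slack x q v"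
proof -
  have v: "v \<in> W" by fact
  have "sum x (nbrs E W v) \<le> sum x (W - part (col v))"
    using finite_W assms(1) nbrs_other_parts[OF v] by (intro sum_mono2) auto
  also have "\<dots> = sum x W - sum x (part (col v))"
    by (rule sum_diff[OF finite_W part_subset])
  finally have 1: "sum x (nbrs E W v) \<le> sum x W - sum x (part (col v))" .
  have "card (nbrs E W v) \<le> card (W - part (col v))"
    using finite_W nbrs_other_parts[OF v] by (intro card_mono) auto
  then have 2: "real (card (W - part (col v)) - card (nbrs E W v))
      = real (card W) - real (card (part (col v))) - real (card (nbrs E W v))"
    using card_other_parts[of "col v"] by (simp add: of_nat_diff)
  have "q * x v = real (card (nbrs E W v)) * x v + sum x (nbrs E W v)"
    using bspec[OF assms(2) v] by (simp add: sl_apply_altdef)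
  then show ?thesis using 1 unfolding 2 slack_def by (simp add: algebra_simps)
qed

lemma slack_nonneg:
  assumes "\<forall>u. x u \<ge> 0" "\<forall>u\<in>W. sl_apply E W x u = q * x u" "v \<in> W"
  shows "0 \<le> slack x q v"
  by (rule order_trans[OF _ missing_nbrs_le_slack[OF assms]]) (use assms(1) in auto)

lemma sum_slack:
  assumes c: "c = q - real (card W)" "c > 0"
  shows "sum x W * (part_sum c - 1)
    = (\<Sum>i\<in>K. sum (slack x q) (part i) / (c + 2 * real (card (part i))))"
proof -
  have "sum (slack x q) (part i) / (c + 2 * real (card (part i)))
      = sum x W * (real (card (part i)) / (c + 2 * real (card (part i)))) - sum x (part i)" for i
  proof -
    have "sum (slack x q) (part i) = (\<Sum>v\<in>part i. (real (card W) - real (card (part i))) * x v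
      + (sum x W - sum x (part i)) - q * x v)"
      by (intro sum.cong) (auto simp: slack_def part_def)
    also have "\<dots> = (real (card W) - real (card (part i))) * sum x (part i)
      + real (card (part i)) * (sum x W - sum x (part i)) - q * sum x (part i)"
      by (simp add: sum.distrib sum_subtractf sum_distrib_left)
    also have "\<dots> = real (card (part i)) * sum x W - (c + 2 * real (card (part i))) * sum x (part i)"
      by (simp add: c(1) algebra_simps)
    finally show ?thesis using c(2) by (simp add: field_simps)
  qed
  then have "(\<Sum>i\<in>K. sum (slack x q) (part i) / (c + 2 * real (card (part i))))
    = sum x W * part_sum c - (\<Sum>i\<in>K. sum x (part i))"
    by (simp add: part_sum_def sum_subtractf sum_distrib_left)
  then show ?thesis
    by (simp add: sum_over_parts algebra_simps)
qed

lemma part_sum_ge_1: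
  assumes "sl_index E W > real (card W)"
  shows "part_sum (sl_index E W - real (card W)) \<ge> 1"
proof -
  define c where "c = sl_index E W - real (card W)"
  have c: "c > 0" using assms by (simp add: c_def)
  obtain x :: "'a \<Rightarrow> real" where x: "\<And>u. x u \<ge> 0" "(\<Sum>u\<in>W. (x u)\<^sup>2) = 1"
    "\<And>u. u \<in> W \<Longrightarrow> sl_apply E W x u = sl_index E W * x u"
    using sl_index_perron[OF finite_W W_nonempty sym_E irrefl_E] by metis
  have "sum x W \<noteq> 0"
  proof
    assume "sum x W = 0"
    then have "x u = 0" if "u \<in> W" for u using that x(1) finite_W by (simp add: sum_nonneg_eq_0_iff)
    then show False using x(2) by simp
  qed
  then have S: "sum x W > 0" using x(1) by (simp add: sum_nonneg less_le)
  have "0 \<le> sum x W * (part_sum c - 1)"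
    unfolding sum_slack[OF c_def c] using slack_nonneg[of x "sl_index E W"] c x(1,3)
    by (intro sum_nonneg divide_nonneg_nonneg) (auto simp: part_def)
  then show "part_sum (sl_index E W - real (card W)) \<ge> 1"
    using S by (simp add: zero_le_mult_iff c_def)
qed

text \<open>
  Equality makes all slacks vanish. The degree condition makes any two vertices have a common
  neighbour, so a zero entry of the Perron vector would spread to all vertices; as the entries are
  positive, zero slack means that no neighbour in another part is missing.
\<close>

lemma complete_if_part_sum_eq_1:
  assumes "sl_index E W > real (card W)" "part_sum (sl_index E W - real (card W)) = 1"
    and deg: "\<And>u. u \<in> W \<Longrightarrow> real (card W) < 2 * real (card (nbrs E W u))"
    and uw: "u \<in> W" "w \<in> W" "col u \<noteq> col w"
  shows "(u, w) \<in> E"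
proof -
  define c where "c = sl_index E W - real (card W)"
  have c: "c > 0" using assms by (simp add: c_def)
  obtain x :: "'a \<Rightarrow> real" where x: "\<And>u. x u \<ge> 0" "(\<Sum>u\<in>W. (x u)\<^sup>2) = 1"
    "\<And>u. u \<in> W \<Longrightarrow> sl_apply E W x u = sl_index E W * x u"
    using sl_index_perron[OF finite_W W_nonempty sym_E irrefl_E] by metis
  have x': "\<forall>u. x u \<ge> 0" "\<forall>u\<in>W. sl_apply E W x u = sl_index E W * x u" using x by auto
  have zero: "x b = 0" if "a \<in> W" "x a = 0" "b \<in> nbrs E W a" for a b
  proof -
    have "sum x (nbrs E W a) = 0" using x(3)[OF that(1)] that(2) by (simp add: sl_apply_altdef)
    then show ?thesis using that(3) x(1) finite_W by (simp add: sum_nonneg_eq_0_iff)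
  qed
  have pos: "x a > 0" if a: "a \<in> W" for a
  proof (rule ccontr)
    assume "\<not> x a > 0"
    then have xa: "x a = 0" using x(1)[of a] by simp
    have "x b = 0" if b: "b \<in> W" for b
    proof -
      have "nbrs E W a \<inter> nbrs E W b \<noteq> {}"
      proof
        assume "nbrs E W a \<inter> nbrs E W b = {}"
        then have "card (nbrs E W a) + card (nbrs E W b) = card (nbrs E W a \<union> nbrs E W b)"
          using finite_W by (simp add: card_Un_disjoint)
        also have "\<dots> \<le> card W" using finite_W by (intro card_mono) (auto simp: nbrs_def)
        finally show False using deg[OF a] deg[OF b] by linarith
      qed
      then obtain z where z: "z \<in> nbrs E W a" "z \<in> nbrs E W b" by auto
      have "x z = 0" using zero[OF a xa z(1)] .
      moreover have "z \<in> W" "b \<in> nbrs E W z" using z b symD[OF sym_E] by (auto simp: nbrs_def)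
      ultimately show "x b = 0" using zero by blast
    qed
    then show False using x(2) by simp
  qed
  let ?slack = "slack x (sl_index E W)"
  have "(\<Sum>i\<in>K. sum ?slack (part i) / (c + 2 * real (card (part i)))) = 0"
    using sum_slack[OF c_def c, of x] assms(2) by (simp add: c_def)
  moreover have "0 \<le> sum ?slack (part i) / (c + 2 * real (card (part i)))" for i
    using slack_nonneg[OF x'] c by (intro divide_nonneg_nonneg sum_nonneg) (auto simp: part_def)
  moreover have "col u \<in> K" using uw(1) col_K by auto
  ultimately have "sum ?slack (part (col u)) / (c + 2 * real (card (part (col u)))) = 0"
    using finite_K by (simp add: sum_nonneg_eq_0_iff)
  then have "sum ?slack (part (col u)) = 0" using c by (smt (verit) divide_eq_0_iff of_nat_0_le_iff)
  moreover have "\<forall>v\<in>part (col u). 0 \<le> ?slack v" using slack_nonneg[OF x'] by (auto simp: part_def)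
  moreover have "u \<in> part (col u)" using uw(1) by (simp add: part_def)
  ultimately have "?slack u = 0" using finite_part by (simp add: sum_nonneg_eq_0_iff)
  then have "real (card (W - part (col u)) - card (nbrs E W u)) \<le> 0"
    using missing_nbrs_le_slack[OF x' uw(1)] pos[OF uw(1)] by (simp add: mult_le_0_iff)
  then have "card (W - part (col u)) \<le> card (nbrs E W u)" by simp
  then have "nbrs E W u = W - part (col u)"
    using nbrs_other_parts[OF uw(1)] finite_W by (intro card_seteq) auto
  moreover have "w \<in> W - part (col u)" using uw by (simp add: part_def)
  ultimately have "w \<in> nbrs E W u" by blast
  then show ?thesis by (simp add: nbrs_def)
qed

lemma part_sum_le_chord:
  assumes "c > 0" "a \<ge> 0" "b \<ge> 0"
    and "\<And>i. i \<in> K \<Longrightarrow> 0 \<le> (real (card (part i)) - a) * (real (card (part i)) - b)"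
  defines "chord \<equiv> real (card K) * (a / (c + 2 * a))
      + c * (real (card W) - real (card K) * a) / ((c + 2 * a) * (c + 2 * b))"
  shows "part_sum c \<le> chord"
    and "part_sum c = chord \<longleftrightarrow>
      (\<forall>i\<in>K. (real (card (part i)) - a) * (real (card (part i)) - b) = 0)"
proof -
  define t where "t i = real (card (part i))" for i
  define gap where "gap i = 2 * c * (t i - a) * (t i - b) / ((c + 2 * a) * (c + 2 * b) * (c + 2 * t i))" for i
  have t0: "t i \<ge> 0" for i by (simp add: t_def)
  have "(\<Sum>i\<in>K. gap i) = (\<Sum>i\<in>K. a / (c + 2 * a) + c * (t i - a) / ((c + 2 * a) * (c + 2 * b)) - t i / (c + 2 * t i))"
    unfolding gap_def using chord_minus_fraction[OF assms(1-3) t0] by simp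
  also have "\<dots> = real (card K) * (a / (c + 2 * a)) + c * (sum t K - real (card K) * a) / ((c + 2 * a) * (c + 2 * b)) - part_sum c"
    by (simp add: sum.distrib sum_subtractf part_sum_def t_def sum_distrib_left[symmetric] sum_divide_distrib[symmetric])
  also have "sum t K = real (card W)" using sum_card_parts by (simp add: t_def)
  finally have gap: "(\<Sum>i\<in>K. gap i) = chord - part_sum c" by (simp add: chord_def)
  have pos: "(c + 2 * a) * (c + 2 * b) * (c + 2 * t i) > 0" for i
    using assms(1-3) t0[of i] by (intro mult_pos_pos) auto
  have gap0: "gap i \<ge> 0" if "i \<in> K" for i
  proof -
    have "0 \<le> 2 * c * ((t i - a) * (t i - b))"
      using assms(4)[OF that] assms(1) by (simp add: t_def)
    then show ?thesis unfolding gap_def using pos[of i]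
      by (intro divide_nonneg_nonneg) (auto simp: mult.assoc)
  qed
  then have "0 \<le> (\<Sum>i\<in>K. gap i)" by (intro sum_nonneg) auto
  then show "part_sum c \<le> chord" using gap by simp
  have "part_sum c = chord \<longleftrightarrow> (\<Sum>i\<in>K. gap i) = 0" using gap by auto
  also have "\<dots> \<longleftrightarrow> (\<forall>i\<in>K. gap i = 0)" using gap0 finite_K by (simp add: sum_nonneg_eq_0_iff)
  also have "\<dots> \<longleftrightarrow> (\<forall>i\<in>K. (t i - a) * (t i - b) = 0)"
    using pos assms(1) unfolding gap_def by (intro ball_cong refl) (smt (verit) divide_eq_0_iff mult_eq_0_iff)
  finally show "part_sum c = chord \<longleftrightarrow>
      (\<forall>i\<in>K. (real (card (part i)) - a) * (real (card (part i)) - b) = 0)" by (simp add: t_def)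
qed

text \<open>
  The tangent of \<open>t / (c + 2t)\<close> at the average part size bounds \<open>part_sum\<close> from above.
\<close>

lemma sl_index_le_multipartite:
  assumes "2 \<le> card K"
  shows "sl_index E W \<le> 2 * (1 - 1 / real (card K)) * real (card W)"
proof (cases "sl_index E W > real (card W)")
  case False
  have "1 \<le> 2 * (1 - 1 / real (card K))" using assms by (simp add: field_simps)
  then have "1 * real (card W) \<le> 2 * (1 - 1 / real (card K)) * real (card W)"
    by (intro mult_right_mono) auto
  with False show ?thesis by simp
next
  case True
  define c where "c = sl_index E W - real (card W)"
  define a where "a = real (card W) / real (card K)"
  have c: "c > 0" using True by (simp add: c_def)
  have K: "real (card K) > 0" using assms by simp
  have Ka: "real (card K) * a = real (card W)" using K by (simp add: a_def)
  have "1 \<le> part_sum c" using part_sum_ge_1[OF True] by (simp add: c_def)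
  also have "\<dots> \<le> real (card K) * (a / (c + 2 * a)) + c * (real (card W) - real (card K) * a) / ((c + 2 * a) * (c + 2 * a))"
    using c by (intro part_sum_le_chord(1)) (auto simp: a_def)
  also have "\<dots> = real (card W) / (c + 2 * a)" by (simp add: Ka)
  finally have "1 \<le> real (card W) / (c + 2 * a)" .
  moreover have "c + 2 * a > 0" using c by (simp add: a_def add_pos_nonneg)
  ultimately have "c + 2 * a \<le> real (card W)" by (simp add: le_divide_eq)
  then show ?thesis unfolding c_def a_def by (simp add: algebra_simps)
qed

end

lemma turan_coloured_graph:
  assumes "n \<ge> 1" "r \<ge> 1"
  shows "coloured_graph (parcs (turan_graph n r)) {..<n} {..<r} (\<lambda>v. v mod r)"
  using assms by unfold_locales
    (auto simp: turan_graph_def sym_def irrefl_def lessThan_empty_iff)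

abbreviation turan_index :: "nat \<Rightarrow> nat \<Rightarrow> real" where
  "turan_index n r \<equiv> sl_index (parcs (turan_graph n r)) {..<n}"

lemma nbrs_turan:
  assumes "v < n"
  shows "nbrs (parcs (turan_graph n r)) {..<n} v = {..<n} - {w. w < n \<and> w mod r = v mod r}"
  using assms by (auto simp: nbrs_def turan_graph_def)

lemma turan_part_cases:
  assumes "i < r"
  shows "card {v. v < n \<and> v mod r = i} = n div r \<or> card {v. v < n \<and> v mod r = i} = n div r + 1"
  using card_turan_part[OF assms, of n] by simp

text \<open>
  The Rayleigh quotient of the constant vector is twice the average degree. The error term has to
  vanish as \<open>n\<close> grows, so the sum of the squared part sizes is computed up to a constant.
\<close>

lemma turan_index_ge_average:
  assumes "n \<ge> 1" "r \<ge> 1"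
  shows "turan_index n r \<ge> 2 * (1 - 1 / real r) * real n - 2 * real r / real n"
proof -
  interpret coloured_graph "parcs (turan_graph n r)" "{..<n}" "{..<r}" "\<lambda>v. v mod r"
    by (rule turan_coloured_graph[OF assms])
  let ?E = "parcs (turan_graph n r)" and ?W = "{..<n}"
  define t where "t i = real (card (part i))" for i
  have part: "part i = {v. v < n \<and> v mod r = i}" for i by (auto simp: part_def)
  have deg: "real (card (nbrs ?E ?W v)) = real n - t (v mod r)" if "v < n" for v
    using card_other_parts[of "v mod r"] nbrs_turan[OF that] by (simp add: part t_def)
  have sumt: "(\<Sum>i<r. t i) = real n" using sum_card_parts by (simp add: t_def)
  have "(\<Sum>v<n. real n - t (v mod r)) = (\<Sum>i<r. \<Sum>v\<in>part i. real n - t (v mod r))"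
    by (rule sum_over_parts[symmetric])
  also have "\<dots> = (\<Sum>i<r. \<Sum>v\<in>part i. real n - t i)"
    by (intro sum.cong refl) (simp add: part)
  also have "\<dots> = (\<Sum>i<r. t i * (real n - t i))" by (simp add: t_def)
  also have "\<dots> = (\<Sum>i<r. (real n - 2 * (real n / real r)) * t i + (real n / real r)\<^sup>2 - (t i - real n / real r)\<^sup>2)"
    by (intro sum.cong refl) (simp add: power2_eq_square algebra_simps)
  also have "\<dots> = (real n - 2 * (real n / real r)) * real n + real r * (real n / real r)\<^sup>2 - (\<Sum>i<r. (t i - real n / real r)\<^sup>2)"
    by (simp add: sum.distrib sum_subtractf sum_distrib_left[symmetric] sumt)
  also have "(real n - 2 * (real n / real r)) * real n + real r * (real n / real r)\<^sup>2 = (1 - 1 / real r) * (real n)\<^sup>2"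
    using assms by (simp add: power2_eq_square field_simps)
  finally have S: "(\<Sum>v<n. real n - t (v mod r)) = (1 - 1 / real r) * (real n)\<^sup>2 - (\<Sum>i<r. (t i - real n / real r)\<^sup>2)" .
  have "(\<Sum>i<r. (t i - real n / real r)\<^sup>2) \<le> (\<Sum>i<r. 1)"
  proof (intro sum_mono)
    fix i assume "i \<in> {..<r}"
    then have "i < r" by simp
    have eq: "real n = real r * real (n div r) + real (n mod r)"
      by (metis mult_div_mod_eq of_nat_add of_nat_mult)
    have "real n / real r = real (n div r) + real (n mod r) / real r"
      by (subst eq) (use assms in \<open>simp add: field_simps\<close>)
    moreover have "0 \<le> real (n mod r) / real r" "real (n mod r) / real r \<le> 1"
      using assms by (auto simp: less_imp_le)
    moreover have "t i = real (n div r) \<or> t i = real (n div r) + 1"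
      using turan_part_cases[OF \<open>i < r\<close>, of n] by (auto simp: t_def part)
    ultimately have "\<bar>t i - real n / real r\<bar> \<le> 1" by auto
    then show "(t i - real n / real r)\<^sup>2 \<le> 1" by (simp add: abs_square_le_1)
  qed
  then have S': "(1 - 1 / real r) * (real n)\<^sup>2 - real r \<le> (\<Sum>v<n. real n - t (v mod r))"
    using S by simp
  have "sl_form ?E ?W (\<lambda>_. 1) = (\<Sum>v<n. 2 * (real n - t (v mod r)))"
    unfolding sl_form_def sl_apply_def by (intro sum.cong refl) (simp add: deg)
  also have "\<dots> = 2 * (\<Sum>v<n. real n - t (v mod r))" by (simp add: sum_distrib_left)
  finally have "2 * (\<Sum>v<n. real n - t (v mod r)) \<le> turan_index n r * real n"
    using sl_form_le_sl_index[OF finite_W W_nonempty, of ?E "\<lambda>_. 1"] by simp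
  then have "2 * ((1 - 1 / real r) * (real n)\<^sup>2 - real r) \<le> turan_index n r * real n" using S' by simp
  then show ?thesis using assms by (simp add: field_simps power2_eq_square)
qed

text \<open>
  The test vector is \<open>1 / (c + 2t)\<close> on a part of size \<open>t\<close>: the signless Laplacian maps it to
  \<open>n + c\<close> times itself plus the constant \<open>part_sum c - 1\<close>.
\<close>

lemma turan_index_ge:
  assumes "n \<ge> 1" "r \<ge> 1" "c > 0"
    and "coloured_graph.part_sum {..<n} {..<r} (\<lambda>v. v mod r) c \<ge> 1"
  shows "turan_index n r \<ge> real n + c"
    and "coloured_graph.part_sum {..<n} {..<r} (\<lambda>v. v mod r) c > 1 \<Longrightarrow> turan_index n r > real n + c"
proof -
  interpret coloured_graph "parcs (turan_graph n r)" "{..<n}" "{..<r}" "\<lambda>v. v mod r"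
    by (rule turan_coloured_graph[OF assms(1,2)])
  let ?E = "parcs (turan_graph n r)" and ?W = "{..<n}"
  define t where "t i = real (card (part i))" for i
  define y where "y v = 1 / (c + 2 * t (v mod r))" for v
  have part: "part i = {v. v < n \<and> v mod r = i}" for i by (auto simp: part_def)
  have ypos: "y v > 0" for v using assms(3) by (simp add: y_def t_def add_pos_nonneg)
  have yt: "y v * (c + 2 * t (v mod r)) = 1" for v
  proof -
    have "c + 2 * t (v mod r) > 0" using assms(3) by (simp add: t_def add_pos_nonneg)
    then show ?thesis by (simp add: y_def)
  qed
  have ysum: "sum y (part i) = t i / (c + 2 * t i)" for i
  proof -
    have "sum y (part i) = (\<Sum>v\<in>part i. 1 / (c + 2 * t i))"
      by (intro sum.cong refl) (simp add: part y_def)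
    then show ?thesis by (simp add: t_def)
  qed
  have sumy: "sum y ?W = part_sum c"
    using sum_over_parts[of y] by (simp add: ysum part_sum_def t_def)
  have apply_y: "y v * sl_apply ?E ?W y v = (real n + c) * (y v)\<^sup>2 + (part_sum c - 1) * y v" if v: "v < n" for v
  proof -
    have nb: "nbrs ?E ?W v = ?W - part (v mod r)" using nbrs_turan[OF v] by (simp add: part)
    have "sum y (nbrs ?E ?W v) = part_sum c - t (v mod r) / (c + 2 * t (v mod r))"
      unfolding nb sum_diff[OF finite_W part_subset] sumy ysum ..
    moreover have "t (v mod r) / (c + 2 * t (v mod r)) = t (v mod r) * y v" by (simp add: y_def)
    moreover have "real (card (nbrs ?E ?W v)) = real n - t (v mod r)"
      unfolding nb card_other_parts by (simp add: t_def)
    ultimately have "sl_apply ?E ?W y v = (real n - t (v mod r)) * y v + (part_sum c - t (v mod r) * y v)"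
      unfolding sl_apply_altdef by simp
    also have "\<dots> = (real n + c) * y v - y v * (c + 2 * t (v mod r)) + part_sum c"
      by (simp add: algebra_simps)
    also have "\<dots> = (real n + c) * y v + (part_sum c - 1)" unfolding yt by simp
    finally have s: "sl_apply ?E ?W y v = (real n + c) * y v + (part_sum c - 1)" .
    show ?thesis unfolding s by (simp add: power2_eq_square algebra_simps)
  qed
  have "sl_form ?E ?W y = (\<Sum>v\<in>?W. (real n + c) * (y v)\<^sup>2 + (part_sum c - 1) * y v)"
    unfolding sl_form_def by (intro sum.cong refl apply_y) simp
  also have "\<dots> = (real n + c) * (\<Sum>v\<in>?W. (y v)\<^sup>2) + (part_sum c - 1) * part_sum c"
    by (simp add: sum.distrib sum_distrib_left[symmetric] sumy)
  finally have main: "(real n + c) * (\<Sum>v\<in>?W. (y v)\<^sup>2) + (part_sum c - 1) * part_sum c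
      \<le> turan_index n r * (\<Sum>v\<in>?W. (y v)\<^sup>2)"
    using sl_form_le_sl_index[OF finite_W W_nonempty, of ?E y] by simp
  have Y: "(\<Sum>v\<in>?W. (y v)\<^sup>2) > 0"
    by (intro sum_pos finite_W W_nonempty zero_less_power ypos)
  have "0 \<le> (part_sum c - 1) * part_sum c" using assms(4) by simp
  then have "(real n + c) * (\<Sum>v\<in>?W. (y v)\<^sup>2) \<le> turan_index n r * (\<Sum>v\<in>?W. (y v)\<^sup>2)" using main by linarith
  then show "turan_index n r \<ge> real n + c" using Y by simp
  assume "part_sum c > 1"
  then have "0 < (part_sum c - 1) * part_sum c" by simp
  then have "(real n + c) * (\<Sum>v\<in>?W. (y v)\<^sup>2) < turan_index n r * (\<Sum>v\<in>?W. (y v)\<^sup>2)" using main by linarith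
  then show "turan_index n r > real n + c" using Y by simp
qed

text \<open>
  With \<open>m = n div r\<close>, the chord through \<open>m\<close> and \<open>m + 1\<close> bounds \<open>part_sum\<close> for every choice of \<open>r\<close> part
  sizes with sum \<open>n\<close> by the same number, which is attained exactly when all sizes are \<open>m\<close> or
  \<open>m + 1\<close>, in particular by the Turan graph.
\<close>

lemma (in coloured_graph) compare_with_turan:
  assumes r: "card K = r" "r \<ge> 1" and big: "sl_index E W > real (card W)"
    and ge: "sl_index E W \<ge> turan_index (card W) r"
    and deg: "\<forall>u\<in>W. real (card W) < 2 * real (card (nbrs E W u))"
  shows "sl_index E W = turan_index (card W) r"
    and "\<And>i. i \<in> K \<Longrightarrow> card (part i) = card W div r \<or> card (part i) = card W div r + 1"
    and "\<And>u w. u \<in> W \<Longrightarrow> w \<in> W \<Longrightarrow> (u, w) \<in> E \<longleftrightarrow> col u \<noteq> col w"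
proof -
  define n where "n = card W"
  define m where "m = n div r"
  define c where "c = sl_index E W - real (card W)"
  have c: "c > 0" using big by (simp add: c_def)
  have n: "n \<ge> 1" using finite_W W_nonempty by (simp add: n_def Suc_le_eq card_gt_0_iff)
  interpret T: coloured_graph "parcs (turan_graph n r)" "{..<n}" "{..<r}" "\<lambda>v. v mod r"
    by (rule turan_coloured_graph[OF n r(2)])
  define chord where "chord = real r * (real m / (c + 2 * real m))
      + c * (real n - real r * real m) / ((c + 2 * real m) * (c + 2 * (real m + 1)))"
  have int: "0 \<le> (real t - real m) * (real t - (real m + 1))" for t
  proof (cases "t \<le> m")
    case True
    then show ?thesis by (intro mult_nonpos_nonpos) auto
  qed (auto intro!: mult_nonneg_nonneg)
  have Tpart: "T.part i = {v. v < n \<and> v mod r = i}" for i by (auto simp: T.part_def)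
  have "(real (card (T.part i)) - real m) * (real (card (T.part i)) - (real m + 1)) = 0"
    if "i \<in> {..<r}" for i
    using turan_part_cases[of i r n] that by (auto simp: Tpart m_def)
  then have "T.part_sum c = chord"
    using T.part_sum_le_chord(2)[of c "real m" "real m + 1"] c int by (simp add: chord_def)
  have le: "part_sum c \<le> chord"
    using part_sum_le_chord(1)[of c "real m" "real m + 1"] c int by (simp add: chord_def r n_def)
  have ge1: "1 \<le> part_sum c" using part_sum_ge_1[OF big] by (simp add: c_def)
  have nq: "real n + c = sl_index E W" by (simp add: n_def c_def)
  have T1: "T.part_sum c \<ge> 1" using le ge1 \<open>T.part_sum c = chord\<close> by simp
  have "turan_index n r \<ge> sl_index E W"
    using turan_index_ge(1)[OF n r(2) c T1] nq by simp
  then show eq: "sl_index E W = turan_index (card W) r" using ge by (simp add: n_def)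
  have "\<not> T.part_sum c > 1"
    using turan_index_ge(2)[OF n r(2) c T1] nq eq by (auto simp: n_def)
  then have chord1: "part_sum c = chord" "part_sum c = 1"
    using le ge1 \<open>T.part_sum c = chord\<close> by auto
  show "card (part i) = card W div r \<or> card (part i) = card W div r + 1" if "i \<in> K" for i
  proof -
    have "(real (card (part i)) - real m) * (real (card (part i)) - (real m + 1)) = 0"
      using part_sum_le_chord(2)[of c "real m" "real m + 1"] c int chord1(1) that
      by (simp add: chord_def r n_def)
    then have "real (card (part i)) = real m \<or> real (card (part i)) = real (m + 1)" by auto
    then show ?thesis unfolding of_nat_eq_iff m_def n_def .
  qed
  show "(u, w) \<in> E \<longleftrightarrow> col u \<noteq> col w" if "u \<in> W" "w \<in> W" for u w
    using proper[OF that] complete_if_part_sum_eq_1[OF big _ deg[rule_format] that] chord1(2) by (auto simp: c_def)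
qed

section \<open>Near-extremal graphs have large minimum degree\<close>

text \<open>
  Since \<open>x v\<close> is the smallest entry, the squares of the entries on non-neighbours of \<open>v\<close> are at least
  \<open>(x v)\<^sup>2\<close>, which bounds those on the neighbours from above whatever the degree of \<open>v\<close> is. So
  deleting \<open>v\<close> costs little unless \<open>x v\<close> is large, and a relative drop \<open>b\<close> of the index forces it to be
  large.
\<close>

lemma delete_min_vertex:
  fixes x :: "'a \<Rightarrow> real"
  assumes W: "finite W" "W \<noteq> {v}" and E: "sym E" "irrefl E"
    and x: "(\<Sum>u\<in>W. (x u)\<^sup>2) = 1" "\<And>u. u \<in> W \<Longrightarrow> sl_apply E W x u = sl_index E W * x u"
    and v: "v \<in> W" "\<And>u. u \<in> W \<Longrightarrow> (x v)\<^sup>2 \<le> (x u)\<^sup>2"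
    and drop: "sl_index E (W - {v}) \<le> sl_index E W * (1 - b)"
  shows "sl_index E W * b \<le> 1 + (sl_index E W - real (card W) + sl_index E W * b) * (x v)\<^sup>2"
proof -
  define q where "q = sl_index E W"
  let ?N = "nbrs E W v"
  have sub: "?N \<subseteq> W" by (rule nbrs_subset)
  have "card (W - ?N) = card W - card ?N" using W(1) by (intro card_Diff_subset nbrs_subset) simp
  then have c: "real (card (W - ?N)) = real (card W) - real (card ?N)"
    using card_nbrs_le[OF W(1), of E v] by (simp add: of_nat_diff)
  have "(real (card W) - real (card ?N)) * (x v)\<^sup>2 = (\<Sum>u\<in>W - ?N. (x v)\<^sup>2)" using c by simp
  also have "\<dots> \<le> (\<Sum>u\<in>W - ?N. (x u)\<^sup>2)" using v(2) by (intro sum_mono) auto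
  also have "\<dots> = 1 - (\<Sum>u\<in>?N. (x u)\<^sup>2)" using sum_diff[OF W(1) sub, of "\<lambda>u. (x u)\<^sup>2"] x(1) by simp
  finally have N: "(\<Sum>u\<in>?N. (x u)\<^sup>2) \<le> 1 - (real (card W) - real (card ?N)) * (x v)\<^sup>2" by simp
  have rest: "(\<Sum>u\<in>W - {v}. (x u)\<^sup>2) = 1 - (x v)\<^sup>2"
    using x(1) W(1) v(1) by (simp add: sum_diff1)
  have ne: "W - {v} \<noteq> {}" using W(2) v(1) by auto
  have "sl_form E (W - {v}) x \<le> sl_index E (W - {v}) * (1 - (x v)\<^sup>2)"
    using sl_form_le_sl_index[of "W - {v}" E x] W(1) ne by (simp add: rest)
  also have "\<dots> \<le> q * (1 - b) * (1 - (x v)\<^sup>2)"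
  proof (intro mult_right_mono)
    have "0 \<le> (\<Sum>u\<in>W - {v}. (x u)\<^sup>2)" by (intro sum_nonneg) simp
    then show "0 \<le> 1 - (x v)\<^sup>2" unfolding rest .
  qed (use drop in \<open>simp add: q_def\<close>)
  finally have "q - (2 * q - real (card ?N)) * (x v)\<^sup>2 - (\<Sum>u\<in>?N. (x u)\<^sup>2) \<le> q * (1 - b) * (1 - (x v)\<^sup>2)"
    using sl_form_delete_vertex[OF W(1) E v(1), of x q] x by (simp add: q_def)
  with N have "q - (2 * q - real (card ?N)) * (x v)\<^sup>2 - (1 - (real (card W) - real (card ?N)) * (x v)\<^sup>2)
      \<le> q * (1 - b) * (1 - (x v)\<^sup>2)" by linarith
  then show ?thesis unfolding q_def[symmetric] by (simp add: algebra_simps)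
qed

text \<open>
  The eigenvector equation at \<open>u\<close> reads \<open>(q - d) x\<^sub>u = \<Sum>x\<^sub>w\<close> over the \<open>d\<close> neighbours of \<open>u\<close>. By
  Cauchy-Schwarz and flatness the square of the right-hand side is at most about \<open>d\<^sup>2/h\<close>, while that of
  the left-hand side is at least about \<open>(q - d)\<^sup>2/h\<close>; hence \<open>q \<le> 2d\<close> up to an error.
\<close>

lemma degree_ge_of_flat_eigenvector:
  fixes x :: "'a \<Rightarrow> real"
  assumes W: "finite W" and E: "sym E"
    and x: "(\<Sum>u\<in>W. (x u)\<^sup>2) = 1" "\<And>u. u \<in> W \<Longrightarrow> sl_apply E W x u = sl_index E W * x u"
    and flat: "\<And>u. u \<in> W \<Longrightarrow> s \<le> (x u)\<^sup>2" "1 - e \<le> s * real (card W)" "0 \<le> e" "e \<le> 1"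
    and big: "real (card W) \<le> sl_index E W" and u: "u \<in> W"
  shows "sl_index E W - 5 * e * real (card W) \<le> 2 * real (card (nbrs E W u))"
proof -
  define q h d where "q = sl_index E W" and "h = real (card W)" and "d = real (card (nbrs E W u))"
  let ?N = "nbrs E W u"
  have sub: "?N \<subseteq> W" by (rule nbrs_subset)
  have h: "h > 0" using W u by (auto simp: h_def card_gt_0_iff)
  have d: "0 \<le> d" "d \<le> h" using card_nbrs_le[OF W] by (auto simp: d_def h_def)
  have q: "h \<le> q" "q \<le> 2 * h"
    using big sl_index_le_twice_card[OF W _ E] u by (auto simp: q_def h_def)
  have "card (W - ?N) = card W - card ?N" using W by (intro card_Diff_subset nbrs_subset) simp
  then have c: "real (card (W - ?N)) = h - d"
    using card_nbrs_le[OF W, of E u] by (simp add: of_nat_diff h_def d_def)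
  have "(h - d) * s = (\<Sum>w\<in>W - ?N. s)" using c by simp
  also have "\<dots> \<le> (\<Sum>w\<in>W - ?N. (x w)\<^sup>2)" using flat(1) by (intro sum_mono) auto
  also have "\<dots> = 1 - (\<Sum>w\<in>?N. (x w)\<^sup>2)" using sum_diff[OF W sub, of "\<lambda>u. (x u)\<^sup>2"] x(1) by simp
  finally have N: "(\<Sum>w\<in>?N. (x w)\<^sup>2) \<le> 1 - (h - d) * s" by simp
  have eig: "(q - d) * x u = sum x ?N" using x(2)[OF u] by (simp add: sl_apply_altdef q_def d_def algebra_simps)
  have "(q - d)\<^sup>2 * s \<le> (q - d)\<^sup>2 * (x u)\<^sup>2" using flat(1)[OF u] by (intro mult_left_mono) auto
  also have "\<dots> = (sum x ?N)\<^sup>2" unfolding eig[symmetric] by (simp add: power_mult_distrib)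
  also have "\<dots> \<le> (\<Sum>w\<in>?N. (x w)\<^sup>2) * d"
    unfolding d_def by (rule sum_squared_le_sum_of_squares)
  also have "\<dots> \<le> (1 - (h - d) * s) * d" using N d by (intro mult_right_mono)
  finally have 1: "(q - d)\<^sup>2 * s \<le> (1 - (h - d) * s) * d" .
  have "(q - d)\<^sup>2 * (1 - e) \<le> (q - d)\<^sup>2 * (s * h)" using flat(2) by (intro mult_left_mono) (auto simp: h_def)
  also have "\<dots> = h * ((q - d)\<^sup>2 * s)" by simp
  also have "\<dots> \<le> h * ((1 - (h - d) * s) * d)" using 1 h by (intro mult_left_mono) auto
  also have "\<dots> = d * (h - (h - d) * (s * h))" by (simp add: algebra_simps)
  also have "\<dots> \<le> d * (h - (h - d) * (1 - e))"
    using flat(2) d by (intro mult_left_mono diff_left_mono) (auto simp: h_def)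
  also have "\<dots> = d * d + e * (d * (h - d))" by (simp add: algebra_simps)
  finally have 2: "(q - d)\<^sup>2 * (1 - e) \<le> d * d + e * (d * (h - d))" .
  have "d * (h - d) \<le> h * h" using d h by (intro mult_mono) auto
  moreover have "(q - d)\<^sup>2 \<le> (2 * h)\<^sup>2" using d q by (intro power_mono) auto
  ultimately have "(q - d)\<^sup>2 + d * (h - d) \<le> 5 * (h * h)" by (simp add: power2_eq_square)
  then have "e * ((q - d)\<^sup>2 + d * (h - d)) \<le> e * (5 * (h * h))" using flat(3) by (intro mult_left_mono)
  also have "\<dots> \<le> e * (5 * (h * q))" using flat(3) q h by (intro mult_left_mono) auto
  finally have "q * q - 2 * (q * d) \<le> 5 * (e * (h * q))"
    using 2 by (simp add: algebra_simps power2_eq_square)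
  then have "q * (q - 5 * e * h) \<le> q * (2 * d)" by (simp add: algebra_simps)
  then have "q - 5 * e * h \<le> 2 * d" using q h by (simp add: mult_le_cancel_left)
  then show ?thesis by (simp add: q_def h_def d_def)
qed

text \<open>
  The value is chosen such that the resulting error \<open>60 \<kappa>\<close> in the relative degrees is the \<open>1/(64r\<^sup>3)\<close>
  of \<^locale>\<open>dense_book_free\<close>.
\<close>

definition kappa :: "nat \<Rightarrow> real" where
  "kappa r = 1 / (3840 * real r ^ 3)"

text \<open>
  The number of vertices that the maximizing set \<open>W\<close> needs: the first summand is required by
  \<^locale>\<open>dense_book_free\<close>, the others absorb the terms of order \<open>1/|W|\<close> and leave
  a vertex after a deletion.
\<close>

definition size_bound :: "nat \<Rightarrow> nat \<Rightarrow> real" where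
  "size_bound r k = 64 * real r ^ 3 * real k + 2 / kappa r + 2"

text \<open>
  The lower bound on \<open>|V|\<close> by \<open>size_bound\<close> carries the factor \<open>2\<^bsup>1/\<kappa>\<^esup>\<close> because the maximality of \<open>W\<close>
  together with the trivial estimate \<open>q(W) \<le> 2|W|\<close> only yields \<open>2|W|\<^sup>\<kappa> \<ge> |V|\<^sup>\<kappa>\<close>.
\<close>

lemma near_extremal_book_free_is_colourable:
  fixes E :: "'a rel"
  assumes rk: "r \<ge> 3" and V: "finite V" and E: "sym E" "irrefl E"
    and free: "book_free E V r k"
    and large: "real (card V) \<ge> size_bound r k * 2 powr (1 / kappa r)"
      "real (card V) > 2 * real r / kappa r"
    and index: "sl_index E V \<ge> 2 * (1 - 1 / real r) * real (card V) - 2 * real r / real (card V)"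
  shows "(\<forall>u\<in>V. real (card V) < 2 * real (card (nbrs E V u))) \<and>
    (\<exists>K :: 'a set. \<exists>c. finite K \<and> card K = r \<and> c ` V \<subseteq> K \<and>
      (\<forall>u\<in>V. \<forall>w\<in>V. (u, w) \<in> E \<longrightarrow> c u \<noteq> c w))"
proof -
  define \<kappa> p n a where "\<kappa> = kappa r" and "p = 1 - kappa r" and "n = real (card V)" and "a = 1 - 1 / real r"
  define Phi where "Phi U = sl_index E U / real (card U) powr p" for U
  have r3: "real r \<ge> 3" using rk by simp
  have "(3::real) ^ 3 \<le> real r ^ 3" using r3 by (intro power_mono) auto
  then have r27: "real r ^ 3 \<ge> 27" by simp
  have \<kappa>: "0 < \<kappa>" "\<kappa> \<le> 1 / 96"
  proof -
    have "1 / (3840 * real r ^ 3) \<le> 1 / 96" using r27 rk by (intro divide_left_mono) auto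
    then show "0 < \<kappa>" "\<kappa> \<le> 1 / 96" using r3 by (auto simp: \<kappa>_def kappa_def)
  qed
  have p: "0 \<le> p" "p \<le> 1" "p = 1 - \<kappa>" using \<kappa> by (auto simp: p_def \<kappa>_def)
  have a: "2 / 3 \<le> a" "a \<le> 1" using r3 by (auto simp: a_def field_simps)
  have pw1: "2 powr (1 / \<kappa>) \<ge> 1" using \<kappa> by (intro ge_one_powr_ge_zero) auto
  have sb: "size_bound r k \<ge> 2" "size_bound r k \<ge> 2 / \<kappa>" "size_bound r k \<ge> 64 * real r ^ 3 * real k"
    using \<kappa> by (auto simp: size_bound_def \<kappa>_def)
  have n_sb: "n \<ge> size_bound r k * 2 powr (1 / \<kappa>)" using large(1) by (simp add: n_def \<kappa>_def)
  moreover have "size_bound r k * 1 \<le> size_bound r k * 2 powr (1 / \<kappa>)" using pw1 sb by (intro mult_left_mono) auto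
  ultimately have n: "n \<ge> 2" using sb by linarith
  have n2: "2 * real r / n < \<kappa>"
  proof -
    have "2 * real r < n * \<kappa>" using large(2) \<kappa> by (simp add: n_def \<kappa>_def[symmetric] field_simps)
    then show ?thesis using n by (simp add: field_simps)
  qed
  have Vne: "V \<noteq> {}" using n by (auto simp: n_def)
  have qV: "sl_index E V \<ge> 2 * a * n - \<kappa>" using index n2 by (simp add: a_def n_def)

  have "finite (Phi ` (Pow V - {{}}))" using V by simp
  moreover have "Phi ` (Pow V - {{}}) \<noteq> {}" using Vne by auto
  ultimately obtain W where W: "W \<in> Pow V - {{}}" "Phi W = Max (Phi ` (Pow V - {{}}))"
    using Max_in by (smt (verit) imageE)
  have Phi_max: "Phi U \<le> Phi W" if "U \<subseteq> V" "U \<noteq> {}" for U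
    unfolding W(2) using that V by (intro Max_ge) auto
  have WV: "W \<subseteq> V" "W \<noteq> {}" using W(1) by auto
  have finW: "finite W" using WV V finite_subset by blast
  define h q where "h = real (card W)" and "q = sl_index E W"
  have h1: "h \<ge> 1" using finW WV by (simp add: h_def Suc_le_eq card_gt_0_iff)
  have hn: "h \<le> n" using WV V by (simp add: h_def n_def card_mono)
  have q2: "q \<le> 2 * h" using sl_index_le_twice_card[OF finW WV(2) E(1)] by (simp add: q_def h_def)
  have PhiVW: "sl_index E V / n powr p \<le> q / h powr p"
    using Phi_max[of V] Vne by (simp add: Phi_def n_def h_def q_def)
  have powr_split: "t / t powr p = t powr \<kappa>" if "t > 0" for t :: real
    using that by (simp add: p(3) powr_diff)
  \<comment> \<open>The maximality of \<open>W\<close> against \<open>V\<close>, with \<open>p = 1 - \<kappa>\<close> split off.\<close>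
  have ratio: "sl_index E V / n * n powr \<kappa> \<le> q / h * h powr \<kappa>"
  proof -
    have "sl_index E V / n * n powr \<kappa> = sl_index E V / n powr p"
      using n by (simp flip: powr_split)
    also have "\<dots> \<le> q / h powr p" by (rule PhiVW)
    also have "\<dots> = q / h * h powr \<kappa>" using h1 by (simp flip: powr_split)
    finally show ?thesis .
  qed
  have tauV: "2 * a - \<kappa> / n \<le> sl_index E V / n"
    using divide_right_mono[OF qV, of n] n by (simp add: diff_divide_distrib)
  have kn: "\<kappa> / n \<le> \<kappa>" using \<kappa> n by (simp add: field_simps)
  have hk: "h powr \<kappa> > 0" "h powr \<kappa> \<le> n powr \<kappa>" using h1 hn \<kappa> by (auto intro: powr_mono2)
  have tau: "sl_index E V / n \<le> q / h"
  proof -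
    have "0 \<le> sl_index E V / n" using tauV kn a \<kappa> by linarith
    then have "sl_index E V / n * h powr \<kappa> \<le> sl_index E V / n * n powr \<kappa>"
      using hk by (intro mult_left_mono) auto
    then have "sl_index E V / n * h powr \<kappa> \<le> q / h * h powr \<kappa>" using ratio by linarith
    then show ?thesis by (rule mult_right_le_imp_le[OF _ hk(1)])
  qed
  define \<tau> where "\<tau> = q / h"
  have h0: "h > 0" and n0: "n > 0" using h1 n by simp_all
  have "2 * a - \<kappa> \<le> \<tau>" unfolding \<tau>_def using tau tauV kn by linarith
  moreover have "\<tau> \<le> 2" unfolding \<tau>_def using q2 h0 by (simp add: pos_divide_le_eq)
  ultimately have \<tau>: "2 * a - \<kappa> \<le> \<tau>" "\<tau> \<le> 2" by auto
  have \<tau>54: "\<tau> \<ge> 5 / 4" using \<tau>(1) a \<kappa> by linarith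
  have q\<tau>: "q = \<tau> * h" using h1 by (simp add: \<tau>_def)

  have h_large: "h \<ge> size_bound r k"
  proof -
    have "1 * n powr \<kappa> \<le> sl_index E V / n * n powr \<kappa>"
      using tauV kn a \<kappa> by (intro mult_right_mono) auto
    also have "\<dots> \<le> \<tau> * h powr \<kappa>" using ratio by (simp add: \<tau>_def)
    also have "\<dots> \<le> 2 * h powr \<kappa>" using \<tau>(2) by (intro mult_right_mono) auto
    finally have "n powr \<kappa> / h powr \<kappa> \<le> 2" using hk(1) by (simp add: pos_divide_le_eq)
    then have "(n / h) powr \<kappa> \<le> 2" using n h1 by (simp add: powr_divide)
    then have "((n / h) powr \<kappa>) powr (1 / \<kappa>) \<le> 2 powr (1 / \<kappa>)"
      using \<kappa> by (intro powr_mono2) auto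
    then have "n / h \<le> 2 powr (1 / \<kappa>)" using \<kappa> n h1 by (simp add: powr_powr)
    then have "n \<le> h * 2 powr (1 / \<kappa>)" using h0 by (simp add: pos_divide_le_eq mult.commute)
    then have "size_bound r k * 2 powr (1 / \<kappa>) \<le> h * 2 powr (1 / \<kappa>)" using n_sb by linarith
    then show ?thesis by (rule mult_right_le_imp_le) (use pw1 in linarith)
  qed
  have h2: "h \<ge> 2" "2 / h \<le> \<kappa>"
  proof -
    show "h \<ge> 2" using h_large sb by linarith
    have "2 / \<kappa> \<le> h" using h_large sb by linarith
    then show "2 / h \<le> \<kappa>" using h0 \<kappa> by (simp add: pos_divide_le_eq mult.commute)
  qed

  \<comment> \<open>The maximality of \<open>W\<close> against \<open>W - {v}\<close>, linearized by the concavity of \<open>t\<^sup>p\<close>.\<close>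
  have drop: "sl_index E (W - {v}) \<le> q * (1 - p / h)" if v: "v \<in> W" for v
  proof -
    have cv: "real (card (W - {v})) = h - 1"
      using v finW h1 by (simp add: h_def of_nat_diff)
    have "card (W - {v}) \<noteq> 0" using cv h2(1) by linarith
    then have "W - {v} \<noteq> {}" by (metis card.empty)
    moreover have "W - {v} \<subseteq> V" using WV by blast
    ultimately have "Phi (W - {v}) \<le> Phi W" using Phi_max by blast
    then have "sl_index E (W - {v}) / (h - 1) powr p \<le> q / h powr p"
      unfolding Phi_def cv by (simp add: q_def h_def)
    moreover have "(h - 1) powr p > 0" using h2 by simp
    ultimately have "sl_index E (W - {v}) \<le> q * ((h - 1) powr p / h powr p)"
      by (simp add: pos_divide_le_eq)
    also have "(h - 1) powr p / h powr p = ((h - 1) / h) powr p" using h2 by (simp add: powr_divide)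
    also have "q * ((h - 1) / h) powr p \<le> q * (1 - p + p * ((h - 1) / h))"
      using h2 p \<tau>54 h1 by (intro mult_left_mono powr_le_tangent_at_one) (auto simp: q\<tau>)
    also have "1 - p + p * ((h - 1) / h) = 1 - p / h" using h1 by (simp add: field_simps)
    finally show ?thesis .
  qed
  obtain x :: "'a \<Rightarrow> real" where x: "\<And>u. x u \<ge> 0" "(\<Sum>u\<in>W. (x u)\<^sup>2) = 1"
    "\<And>u. u \<in> W \<Longrightarrow> sl_apply E W x u = q * x u"
    using sl_index_perron[OF finW WV(2) E] unfolding q_def by metis
  define v where "v = arg_min_on x W"
  have v: "v \<in> W" "\<And>u. u \<in> W \<Longrightarrow> x v \<le> x u"
    using arg_min_if_finite[OF finW WV(2), of x] by (auto simp: v_def not_less)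
  have v2: "(x v)\<^sup>2 \<le> (x u)\<^sup>2" if "u \<in> W" for u
    using v(2)[OF that] x(1)[of v] by (intro power_mono)
  define s where "s = (x v)\<^sup>2"
  have hs: "s * h \<le> 1"
  proof -
    have "s * h = (\<Sum>u\<in>W. s)" by (simp add: h_def)
    also have "\<dots> \<le> (\<Sum>u\<in>W. (x u)\<^sup>2)" using v2 by (intro sum_mono) (simp add: s_def)
    finally show ?thesis using x(2) by simp
  qed
  have s0: "0 \<le> s" by (simp add: s_def)
  \<comment> \<open>With \<open>\<tau> - 1 \<ge> 1/4\<close>, the gain \<open>(\<tau> - 1) 12 \<kappa> \<ge> 3 \<kappa>\<close> beats the losses \<open>\<tau> \<kappa> \<le> 2 \<kappa>\<close> and \<open>\<kappa>\<close>.\<close>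
  have flat: "1 - 12 * \<kappa> \<le> s * h"
  proof (rule ccontr)
    assume neg: "\<not> 1 - 12 * \<kappa> \<le> s * h"
    have "W \<noteq> {v}" using h2(1) by (auto simp: h_def)
    from delete_min_vertex[OF finW this E x(2) x(3)[unfolded q_def] v(1) v2 drop[OF v(1), unfolded q_def]]
    have "q * (p / h) \<le> 1 + (q - h + q * (p / h)) * s" by (simp add: q_def h_def s_def)
    then have "\<tau> * p \<le> 1 + (\<tau> - 1) * (s * h) + (\<tau> * p) * s"
      using h1 by (simp add: q\<tau> algebra_simps)
    moreover have "(\<tau> - 1) * (s * h) \<le> (\<tau> - 1) * (1 - 12 * \<kappa>)"
      using neg \<tau>54 by (intro mult_left_mono) auto
    moreover have "(1 / 4) * (12 * \<kappa>) \<le> (\<tau> - 1) * (12 * \<kappa>)"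
      using \<tau>54 \<kappa> by (intro mult_right_mono) auto
    moreover have "(\<tau> * p) * s \<le> \<kappa>"
    proof -
      have "\<tau> * p \<le> 2 * 1" using \<tau> p \<tau>54 by (intro mult_mono) auto
      then have "(\<tau> * p) * s \<le> 2 * s" using s0 by (intro mult_right_mono) auto
      also have "s \<le> 1 / h" using hs h0 by (simp add: pos_le_divide_eq)
      finally show ?thesis using h2(2) by simp
    qed
    moreover have "\<tau> * \<kappa> \<le> 2 * \<kappa>" using \<tau>(2) \<kappa> by (intro mult_right_mono) auto
    moreover have "\<tau> * p = \<tau> - \<tau> * \<kappa>" by (simp add: p(3) algebra_simps)
    moreover have "(\<tau> - 1) * (s * h) < (\<tau> - 1) * (1 - 12 * \<kappa>)"
      using neg \<tau>54 by (intro mult_strict_left_mono) auto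
    ultimately show False by (simp add: algebra_simps)
  qed
  have deg: "q - 60 * \<kappa> * h \<le> 2 * real (card (nbrs E W u))" if u: "u \<in> W" for u
  proof -
    have "real (card W) \<le> sl_index E W" using \<tau>54 h1 by (simp add: q_def[symmetric] h_def[symmetric] q\<tau>)
    from degree_ge_of_flat_eigenvector[OF finW E(1) x(2) x(3)[unfolded q_def] v2 flat[unfolded s_def h_def] _ _ this u]
    show ?thesis using \<kappa> by (simp add: q_def h_def)
  qed
  have eta: "60 * \<kappa> = 1 / (64 * real r ^ 3)" by (simp add: \<kappa>_def kappa_def)
  have \<kappa>h: "\<kappa> * h > 0" using \<kappa> h1 by simp
  have dense: "real (card W) - real (card (nbrs E W u)) \<le> real (card W) / real r + real (card W) / (64 * real r ^ 3)"
    if u: "u \<in> W" for u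
  proof -
    have "2 * a * h - \<kappa> * h \<le> q" unfolding q\<tau> using \<tau>(1) h1
      by (metis left_diff_distrib mult_right_mono order_trans zero_le_one)
    then have "2 * a * h - \<kappa> * h - 60 * (\<kappa> * h) \<le> 2 * real (card (nbrs E W u))" using deg[OF u] by simp
    then have "2 * h - 2 * real (card (nbrs E W u)) \<le> 2 * (h / real r) + 120 * (\<kappa> * h)"
      using \<kappa>h by (simp add: a_def algebra_simps)
    then have "h - real (card (nbrs E W u)) \<le> h / real r + (60 * \<kappa>) * h" by simp
    then show ?thesis unfolding eta by (simp add: h_def)
  qed
  interpret D: dense_book_free E W r k
  proof unfold_locales
    show "book_free E W r k" by (rule book_free_mono[OF free WV(1) V])
    show "64 * real r ^ 3 * real k \<le> real (card W)" using h_large sb(3) by (simp add: h_def)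
  qed (use finW E rk WV dense in auto)
  obtain c where c: "c ` W \<subseteq> D.base" "\<forall>u\<in>W. \<forall>w\<in>W. (u, w) \<in> E \<longrightarrow> c u \<noteq> c w"
    using D.colourable by auto
  interpret C: coloured_graph E W D.base c
    using finW WV E c D.finite_base by unfold_locales auto
  have "q \<le> 2 * a * h"
    using C.sl_index_le_multipartite D.base(2) rk by (simp add: q_def a_def h_def)
  then have q_up: "q / h \<le> 2 * a" using h0 by (simp add: pos_divide_le_eq)
  \<comment> \<open>A missing vertex would cost a factor \<open>1 - \<kappa>/n\<close>, more than the relative error \<open>r/(an\<^sup>2)\<close> of \<open>index\<close>.\<close>
  have "W = V"
  proof (rule ccontr)
    assume "W \<noteq> V"
    then have "card W < card V" using WV V by (intro psubset_card_mono) auto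
    then have hn1: "h \<le> n - 1" by (simp add: h_def n_def)
    have "(2 * a - 2 * real r / n / n) * n powr \<kappa> \<le> sl_index E V / n * n powr \<kappa>"
    proof (intro mult_right_mono)
      have "2 * a * n - 2 * real r / n \<le> sl_index E V" using index by (simp add: a_def n_def)
      then show "2 * a - 2 * real r / n / n \<le> sl_index E V / n"
        using n0 by (simp add: pos_le_divide_eq left_diff_distrib)
    qed auto
    also have "\<dots> \<le> q / h * h powr \<kappa>" by (rule ratio)
    also have "\<dots> \<le> 2 * a * (n - 1) powr \<kappa>"
      using q_up hn1 h1 a \<kappa> by (intro mult_mono powr_mono2) auto
    also have "(n - 1) powr \<kappa> = ((n - 1) / n) powr \<kappa> * n powr \<kappa>"
      using n by (simp add: powr_divide)
    also have "2 * a * (((n - 1) / n) powr \<kappa> * n powr \<kappa>) \<le> 2 * a * ((1 - \<kappa> + \<kappa> * ((n - 1) / n)) * n powr \<kappa>)"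
      using n \<kappa> a by (intro mult_left_mono mult_right_mono powr_le_tangent_at_one) auto
    also have "1 - \<kappa> + \<kappa> * ((n - 1) / n) = 1 - \<kappa> / n" using n by (simp add: field_simps)
    finally have "(2 * a - 2 * real r / n / n) * n powr \<kappa> \<le> (2 * a * (1 - \<kappa> / n)) * n powr \<kappa>"
      by (simp add: mult.assoc)
    then have "2 * a - 2 * real r / n / n \<le> 2 * a * (1 - \<kappa> / n)"
      by (rule mult_right_le_imp_le) (use n in simp)
    then have "2 * a * (\<kappa> / n) \<le> 2 * real r / n / n" by (simp add: algebra_simps)
    then have "2 * a * \<kappa> \<le> 2 * real r / n" using n0 by (simp add: field_simps)
    moreover have "1 * \<kappa> \<le> 2 * a * \<kappa>" using a \<kappa> by (intro mult_right_mono) auto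
    ultimately show False using n2 by simp
  qed
  moreover have "h < 2 * real (card (nbrs E W u))" if "u \<in> W" for u
  proof -
    have "(5 / 4) * h \<le> q" unfolding q\<tau> using \<tau>54 h1 by (intro mult_right_mono) auto
    moreover have "60 * \<kappa> * h \<le> (1 / 64) * h"
    proof (intro mult_right_mono)
      show "60 * \<kappa> \<le> 1 / 64" unfolding eta using r27 rk by (intro divide_left_mono) auto
    qed (use h1 in auto)
    ultimately show ?thesis using deg[OF that] h1 by linarith
  qed
  ultimately show ?thesis
    using c D.base(2) D.finite_base unfolding h_def by blast
qed

section \<open>Matrices, isomorphisms and forbidden books\<close>

lemma pair_graph_props:
  assumes "pair_graph G"
  shows "finite (pverts G)" "sym (parcs G)" "irrefl (parcs G)" "parcs G \<subseteq> pverts G \<times> pverts G"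
    "pair_wf_digraph G"
proof -
  interpret pair_graph G by fact
  show "finite (pverts G)" by (rule pair_finite_verts)
  show "sym (parcs G)" by (rule pair_sym_arcs[unfolded symmetric_def, simplified])
  show "irrefl (parcs G)" using pair_no_loops unfolding irrefl_def by fastforce
  show "parcs G \<subseteq> pverts G \<times> pverts G" using arc_fst_in_verts arc_snd_in_verts by force
  show "pair_wf_digraph G" by unfold_locales
qed

lemma out_degree_eq_card_nbrs:
  assumes "parcs G \<subseteq> pverts G \<times> pverts G"
  shows "out_degree (with_proj G) v = card (nbrs (parcs G) (pverts G) v)"
proof -
  have "out_arcs (with_proj G) v = Pair v ` nbrs (parcs G) (pverts G) v"
    using assms by (auto simp: out_arcs_def nbrs_def image_iff)
  then show ?thesis
    unfolding out_degree_def by (simp add: card_image inj_on_def)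
qed

lemma sum_over_enumeration:
  assumes "distinct vs" "set vs = V"
  shows "(\<Sum>j<length vs. g (vs ! j)) = sum g V"
  using sum.reindex_bij_betw[OF bij_betw_nth[OF assms(1) refl assms(2)[symmetric]]] by simp

lemma signless_laplacian_mult_vec:
  fixes f :: "'a \<Rightarrow> complex"
  assumes G: "pair_graph G" and vs: "distinct vs" "set vs = pverts G" and i: "i < length vs"
  shows "(signless_laplacian vs G *\<^sub>v vec (length vs) (\<lambda>j. f (vs ! j))) $ i
       = (\<Sum>w\<in>nbrs (parcs G) (pverts G) (vs ! i). f (vs ! i) + f w)"
proof -
  let ?n = "length vs" and ?N = "nbrs (parcs G) (pverts G) (vs ! i)"
  note props = pair_graph_props[OF G]
  have deg: "out_degree (with_proj G) v = card (nbrs (parcs G) (pverts G) v)" for v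
    by (rule out_degree_eq_card_nbrs[OF props(4)])
  have "(signless_laplacian vs G *\<^sub>v vec ?n (\<lambda>j. f (vs ! j))) $ i
      = (\<Sum>j<?n. (if i = j then of_nat (card ?N) else 0) * f (vs ! j)
          + (if (vs ! i, vs ! j) \<in> parcs G then 1 else 0) * f (vs ! j))"
    using i unfolding signless_laplacian_def degree_matrix_def adjacency_matrix_def deg
    by (simp add: scalar_prod_def atLeast0LessThan distrib_right)
  also have "\<dots> = of_nat (card ?N) * f (vs ! i)
      + (\<Sum>j<?n. (if (vs ! i, vs ! j) \<in> parcs G then 1 else 0) * f (vs ! j))"
    using i by (simp add: sum.distrib if_distrib[of "\<lambda>t. t * _"] cong: if_cong)
  also have "(\<Sum>j<?n. (if (vs ! i, vs ! j) \<in> parcs G then 1 else 0) * f (vs ! j))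
      = (\<Sum>w\<in>pverts G. (if (vs ! i, w) \<in> parcs G then 1 else 0) * f w)"
    by (rule sum_over_enumeration[OF vs])
  also have "\<dots> = (\<Sum>w\<in>pverts G. if (vs ! i, w) \<in> parcs G then f w else 0)"
    by (intro sum.cong) auto
  also have "\<dots> = sum f ?N"
    unfolding nbrs_def by (rule sum.inter_filter[OF props(1), symmetric])
  finally show ?thesis by (simp add: sum.distrib)
qed

text \<open>
  The Perron vector shows that \<open>sl_index\<close> is an eigenvalue. Conversely, the entrywise absolute value of
  an eigenvector for \<open>ev\<close> has Rayleigh quotient at least \<open>|ev|\<close>, by the triangle inequality.
\<close>

lemma spectral_radius_signless_laplacian:
  assumes G: "pair_graph G" and ne: "pverts G \<noteq> {}" and vs: "distinct vs" "set vs = pverts G"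
  shows "spectral_radius (signless_laplacian vs G) = sl_index (parcs G) (pverts G)"
proof -
  define A n E W where "A = signless_laplacian vs G" and "n = length vs"
    and "E = parcs G" and "W = pverts G"
  note props = pair_graph_props[OF G, folded E_def W_def]
  have W: "W \<noteq> {}" using ne by (simp add: W_def)
  have A: "A \<in> carrier_mat n n"
    by (simp add: A_def n_def signless_laplacian_def degree_matrix_def adjacency_matrix_def)
  have n: "n > 0" using vs ne by (auto simp: n_def)
  have bij: "bij_betw ((!) vs) {..<n} W" unfolding n_def W_def using vs by (intro bij_betw_nth) auto
  have mult: "(A *\<^sub>v vec n (\<lambda>j. f (vs ! j))) $ i = (\<Sum>w\<in>nbrs E W (vs ! i). f (vs ! i) + f w)"
    if "i < n" for f :: "'a \<Rightarrow> complex" and i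
    unfolding A_def n_def E_def W_def
    using that by (intro signless_laplacian_mult_vec G vs) (simp add: n_def)
  have "sl_index E W \<le> spectral_radius A"
  proof -
    obtain x :: "'a \<Rightarrow> real" where x: "\<And>u. x u \<ge> 0" "(\<Sum>u\<in>W. (x u)\<^sup>2) = 1"
      "\<And>u. u \<in> W \<Longrightarrow> sl_apply E W x u = sl_index E W * x u"
      using sl_index_perron[OF props(1) W props(2,3)] by metis
    define v where "v = vec n (\<lambda>j. complex_of_real (x (vs ! j)))"
    have "v \<noteq> 0\<^sub>v n"
    proof
      assume v0: "v = 0\<^sub>v n"
      have "x w = 0" if "w \<in> W" for w
      proof -
        obtain j where j: "j < n" "w = vs ! j" using bij \<open>w \<in> W\<close> by (auto simp: bij_betw_def)
        have "v $ j = 0" unfolding v0 using j(1) by simp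
        then show ?thesis using j by (simp add: v_def)
      qed
      then show False using x(2) by simp
    qed
    moreover have "A *\<^sub>v v = complex_of_real (sl_index E W) \<cdot>\<^sub>v v"
    proof (rule eq_vecI)
      fix i assume "i < dim_vec (complex_of_real (sl_index E W) \<cdot>\<^sub>v v)"
      then have i: "i < n" by (simp add: v_def)
      then have w: "vs ! i \<in> W" using bij by (auto simp: bij_betw_def)
      have "(A *\<^sub>v v) $ i = (\<Sum>w\<in>nbrs E W (vs ! i). complex_of_real (x (vs ! i)) + complex_of_real (x w))"
        unfolding v_def by (rule mult[OF i, of "\<lambda>w. complex_of_real (x w)"])
      also have "\<dots> = complex_of_real (sl_apply E W x (vs ! i))" by (simp add: sl_apply_def)
      also have "\<dots> = complex_of_real (sl_index E W) * complex_of_real (x (vs ! i))"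
        unfolding x(3)[OF w] by simp
      finally show "(A *\<^sub>v v) $ i = (complex_of_real (sl_index E W) \<cdot>\<^sub>v v) $ i"
        using i by (simp add: v_def)
    qed (use A in \<open>simp add: v_def\<close>)
    ultimately have "eigenvalue A (complex_of_real (sl_index E W))"
      using A unfolding eigenvalue_def eigenvector_def by (intro exI[of _ v]) (simp add: v_def)
    then have "norm (complex_of_real (sl_index E W)) \<le> spectral_radius A"
      by (intro spectral_radius_mem_max(2)[OF A n] imageI) (simp add: spectrum_def)
    then show ?thesis by simp
  qed
  moreover have "spectral_radius A \<le> sl_index E W"
  proof -
    obtain ev where ev: "eigenvalue A ev" "spectral_radius A = norm ev"
      using spectral_radius_mem_max(1)[OF A n] by (auto simp: spectrum_def)
    then obtain z where z: "z \<in> carrier_vec n" "z \<noteq> 0\<^sub>v n" "A *\<^sub>v z = ev \<cdot>\<^sub>v z"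
      using A unfolding eigenvalue_def eigenvector_def by auto
    \<comment> \<open>The eigenvector as a function on vertices instead of positions in \<open>vs\<close>.\<close>
    define f where "f w = z $ (inv_into {..<n} ((!) vs) w)" for w
    have f_nth: "f (vs ! j) = z $ j" if "j < n" for j
      using bij that by (simp add: f_def bij_betw_def inv_into_f_f)
    have zf: "z = vec n (\<lambda>j. f (vs ! j))" using z(1) by (intro eq_vecI) (auto simp: f_nth)
    define g where "g w = norm (f w)" for w
    have le: "norm ev * g w \<le> sl_apply E W g w" if w: "w \<in> W" for w
    proof -
      obtain i where i: "i < n" "w = vs ! i" using bij w by (auto simp: bij_betw_def)
      have "ev * f w = (ev \<cdot>\<^sub>v z) $ i" using i z(1) by (simp add: f_nth)
      also have "\<dots> = (A *\<^sub>v vec n (\<lambda>j. f (vs ! j))) $ i" unfolding z(3)[symmetric] by (subst zf) (rule refl)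
      also have "\<dots> = (\<Sum>u\<in>nbrs E W w. f w + f u)" unfolding i(2) by (rule mult[OF i(1)])
      finally have "norm ev * g w = norm (\<Sum>u\<in>nbrs E W w. f w + f u)"
        unfolding g_def norm_mult[symmetric] by simp
      also have "\<dots> \<le> (\<Sum>u\<in>nbrs E W w. g w + g u)"
        unfolding g_def by (rule sum_norm_le) (rule norm_triangle_ineq)
      finally show ?thesis by (simp add: sl_apply_def)
    qed
    have "norm ev * (\<Sum>w\<in>W. (g w)\<^sup>2) = (\<Sum>w\<in>W. g w * (norm ev * g w))"
      by (simp add: sum_distrib_left power2_eq_square algebra_simps)
    also have "\<dots> \<le> (\<Sum>w\<in>W. g w * sl_apply E W g w)"
      using le by (intro sum_mono mult_left_mono) (auto simp: g_def)
    also have "\<dots> \<le> sl_index E W * (\<Sum>w\<in>W. (g w)\<^sup>2)"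
      using sl_form_le_sl_index[OF props(1) W, of E g] by (simp add: sl_form_def)
    finally have "norm ev * (\<Sum>w\<in>W. (g w)\<^sup>2) \<le> sl_index E W * (\<Sum>w\<in>W. (g w)\<^sup>2)" .
    moreover have "(\<Sum>w\<in>W. (g w)\<^sup>2) \<noteq> 0"
    proof
      assume "(\<Sum>w\<in>W. (g w)\<^sup>2) = 0"
      then have g0: "g w = 0" if "w \<in> W" for w using that props(1) by (simp add: sum_nonneg_eq_0_iff)
      have "z = 0\<^sub>v n"
      proof (rule eq_vecI)
        fix j assume "j < dim_vec (0\<^sub>v n :: complex vec)"
        then have j: "j < n" by simp
        then have "vs ! j \<in> W" using bij by (auto simp: bij_betw_def)
        then show "z $ j = 0\<^sub>v n $ j" using g0[of "vs ! j"] j by (simp add: g_def f_nth)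
      qed (use z(1) in simp)
      then show False using z(2) by simp
    qed
    then have "(\<Sum>w\<in>W. (g w)\<^sup>2) > 0" by (simp add: less_le sum_nonneg)
    ultimately show ?thesis unfolding ev(2) by simp
  qed
  ultimately show ?thesis by (simp add: A_def E_def W_def)
qed

lemma signless_laplacian_radius_eq_sl_index:
  assumes "pair_graph G" "pverts G \<noteq> {}"
  shows "signless_laplacian_radius G = sl_index (parcs G) (pverts G)"
proof -
  have "\<exists>vs. distinct vs \<and> set vs = pverts G"
    using finite_distinct_list[OF pair_graph_props(1)[OF assms(1)]] by blast
  from someI_ex[OF this] show ?thesis
    unfolding signless_laplacian_radius_def
    by (intro spectral_radius_signless_laplacian assms) auto
qed

text \<open>
  Arcs are pairs of vertices here, so a bijection of the vertices determines the map on arcs; the head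
  and tail maps of the image are again the projections.
\<close>

lemma graph_isomorphicI:
  assumes "pair_wf_digraph G" "inj_on f (pverts G)"
    and "pverts H = f ` pverts G" "parcs H = map_prod f f ` parcs G"
  shows "graph_isomorphic G H"
proof -
  interpret pair_wf_digraph G by fact
  define hom where "hom = \<lparr>iso_verts = f, iso_arcs = map_prod f f, iso_head = snd, iso_tail = fst\<rparr>"
  have "parcs G \<subseteq> pverts G \<times> pverts G" using arc_fst_in_verts arc_snd_in_verts by force
  then have "inj_on (map_prod f f) (parcs G)"
    using map_prod_inj_on[OF assms(2) assms(2)] inj_on_subset by blast
  then have "pre_digraph.digraph_isomorphism (with_proj G) hom"
    using assms(2) wf_digraph by (simp add: pre_digraph.digraph_isomorphism_def hom_def)
  moreover have "with_proj H = app_iso hom (with_proj G)"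
    by (simp add: app_iso_def with_proj_def hom_def assms(3,4))
  ultimately show ?thesis unfolding graph_isomorphic_def digraph_iso_def by blast
qed

lemma graph_isomorphicE:
  assumes "graph_isomorphic G H" "parcs G \<subseteq> pverts G \<times> pverts G"
  obtains f where "bij_betw f (pverts G) (pverts H)"
    "\<And>u v. u \<in> pverts G \<Longrightarrow> v \<in> pverts G \<Longrightarrow> (f u, f v) \<in> parcs H \<longleftrightarrow> (u, v) \<in> parcs G"
proof -
  obtain hom where hom: "pre_digraph.digraph_isomorphism (with_proj G) hom"
    and H: "with_proj H = app_iso hom (with_proj G)"
    using assms(1) unfolding graph_isomorphic_def digraph_iso_def by auto
  define f where "f = iso_verts hom"
  have inj: "inj_on f (pverts G)" using hom by (simp add: pre_digraph.digraph_isomorphism_def f_def)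
  have HV: "pverts H = f ` pverts G" and HA: "parcs H = iso_arcs hom ` parcs G"
    and HT: "fst = iso_tail hom" "snd = iso_head hom"
    using H by (auto simp: with_proj_def app_iso_def f_def)
  have arc: "iso_arcs hom (u, v) = (f u, f v)" if "(u, v) \<in> parcs G" for u v
  proof (rule prod_eqI)
    show "fst (iso_arcs hom (u, v)) = fst (f u, f v)" "snd (iso_arcs hom (u, v)) = snd (f u, f v)"
      using hom that unfolding pre_digraph.digraph_isomorphism_def f_def HT[symmetric] by force+
  qed
  show ?thesis
  proof (rule that[of f])
    show "bij_betw f (pverts G) (pverts H)" using inj HV by (simp add: bij_betw_def)
    fix u v assume uv: "u \<in> pverts G" "v \<in> pverts G"
    show "(f u, f v) \<in> parcs H \<longleftrightarrow> (u, v) \<in> parcs G"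
    proof
      assume "(u, v) \<in> parcs G"
      then show "(f u, f v) \<in> parcs H" unfolding HA using arc by (metis imageI)
    next
      assume "(f u, f v) \<in> parcs H"
      then obtain a b where ab: "(a, b) \<in> parcs G" "iso_arcs hom (a, b) = (f u, f v)"
        unfolding HA by auto
      then have "f a = f u" "f b = f v" using arc by auto
      moreover have "a \<in> pverts G" "b \<in> pverts G" using ab(1) assms(2) by auto
      ultimately have "a = u" "b = v" using inj uv by (auto dest: inj_onD)
      then show "(u, v) \<in> parcs G" using ab(1) by simp
    qed
  qed
qed

lemma sl_index_le_of_iso:
  assumes W: "finite W" "W \<noteq> {}" and f: "bij_betw f W W'"
    and iso: "\<And>u v. u \<in> W \<Longrightarrow> v \<in> W \<Longrightarrow> (f u, f v) \<in> E' \<longleftrightarrow> (u, v) \<in> E"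
  shows "sl_index E W \<le> sl_index E' W'"
proof -
  obtain x :: "'a \<Rightarrow> real" where x: "(\<Sum>u\<in>W. (x u)\<^sup>2) = 1" "sl_form E W x = sl_index E W"
    using sl_index_attained[OF W, of E] by blast
  define y where "y w = x (inv_into W f w)" for w
  have inj: "inj_on f W" and img: "f ` W = W'" using f by (auto simp: bij_betw_def)
  have yf: "y (f u) = x u" if "u \<in> W" for u using that inj by (simp add: y_def inv_into_f_f)
  have nb: "nbrs E' W' (f u) = f ` nbrs E W u" if "u \<in> W" for u
    using iso that unfolding img[symmetric] by (auto simp: nbrs_def)
  have ap: "sl_apply E' W' y (f u) = sl_apply E W x u" if u: "u \<in> W" for u
  proof -
    have "sl_apply E' W' y (f u) = (\<Sum>w\<in>f ` nbrs E W u. y (f u) + y w)" by (simp add: sl_apply_def nb[OF u])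
    also have "\<dots> = (\<Sum>v\<in>nbrs E W u. y (f u) + y (f v))"
      using inj_on_subset[OF inj nbrs_subset[of E W u]] by (simp add: sum.reindex card_image)
    also have "\<dots> = sl_apply E W x u"
      unfolding sl_apply_def using u by (intro sum.cong refl) (auto simp: yf nbrs_def)
    finally show ?thesis .
  qed
  have "(\<Sum>w\<in>W'. (y w)\<^sup>2) = (\<Sum>u\<in>W. (y (f u))\<^sup>2)"
    unfolding img[symmetric] using inj by (simp add: sum.reindex)
  also have "\<dots> = 1" using x(1) by (simp add: yf)
  finally have y1: "(\<Sum>w\<in>W'. (y w)\<^sup>2) = 1" .
  have "sl_form E' W' y = (\<Sum>u\<in>W. y (f u) * sl_apply E' W' y (f u))"
    unfolding sl_form_def img[symmetric] using inj by (simp add: sum.reindex)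
  also have "\<dots> = sl_form E W x" unfolding sl_form_def by (intro sum.cong refl) (simp add: yf ap)
  finally have "sl_index E W = sl_form E' W' y" using x(2) by simp
  also have "\<dots> \<le> sl_index E' W'"
    using sl_form_le_sl_index[of W' E' y] W img y1 by auto
  finally show ?thesis .
qed

lemma sl_index_iso:
  assumes W: "finite W" "W \<noteq> {}" and f: "bij_betw f W W'"
    and iso: "\<And>u v. u \<in> W \<Longrightarrow> v \<in> W \<Longrightarrow> (f u, f v) \<in> E' \<longleftrightarrow> (u, v) \<in> E"
  shows "sl_index E W = sl_index E' W'"
proof (rule antisym)
  show "sl_index E W \<le> sl_index E' W'" by (rule sl_index_le_of_iso[OF assms])
  let ?g = "inv_into W f"
  have inj: "inj_on f W" and img: "f ` W = W'" using f by (auto simp: bij_betw_def)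
  show "sl_index E' W' \<le> sl_index E W"
  proof (rule sl_index_le_of_iso)
    show "bij_betw ?g W' W" by (rule bij_betw_inv_into[OF f])
    fix u v assume "u \<in> W'" "v \<in> W'"
    then obtain a b where "a \<in> W" "u = f a" "b \<in> W" "v = f b" using img by auto
    then show "(?g u, ?g v) \<in> E \<longleftrightarrow> (u, v) \<in> E'" using iso inj by (simp add: inv_into_f_f)
  qed (use W img in auto)
qed

lemma book_free_of_graph_free:
  assumes G: "pair_graph G" and free: "graph_free (generalized_book r k) G"
  shows "book_free (parcs G) (pverts G) r k"
  unfolding book_free_def
proof (intro allI impI, rule ccontr)
  let ?B = "generalized_book r k"
  note props = pair_graph_props[OF G]
  fix S assume S: "S \<subseteq> pverts G" "card S = r" "clique (parcs G) S"
    and many: "\<not> card (common_nbrs (parcs G) (pverts G) S) < k"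
  have fS: "finite S" using S(1) props(1) finite_subset by blast
  obtain X where X: "X \<subseteq> common_nbrs (parcs G) (pverts G) S" "card X = k" "finite X"
    using obtain_subset_with_card_n[of k "common_nbrs (parcs G) (pverts G) S"] many by auto
  have disj: "S \<inter> X = {}" using X(1) props(3) by (auto simp: common_nbrs_def irrefl_def)
  obtain f where f: "bij_betw f {..<r} S"
    using finite_same_card_bij[of "{..<r}" S] fS S(2) by auto
  obtain g where g: "bij_betw g {r..<r + k} X"
    using finite_same_card_bij[of "{r..<r + k}" X] X(2,3) by auto
  \<comment> \<open>An embedding of the book: its spine goes to \<open>S\<close>, its pages to \<open>X\<close>.\<close>
  define \<phi> where "\<phi> i = (if i < r then f i else g i)" for i
  have fi: "f i \<in> S" if "i < r" for i using f that by (auto simp: bij_betw_def)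
  have gi: "g i \<in> X" if "r \<le> i" "i < r + k" for i using g that by (auto simp: bij_betw_def)
  have pB: "pverts ?B = {..<r} \<union> {r..<r + k}"
    by (auto simp: generalized_book_def graph_join_def complete_graph_def edgeless_graph_def)
  have "bij_betw \<phi> {..<r} S"
    by (rule iffD1[OF bij_betw_cong f]) (simp add: \<phi>_def)
  moreover have "bij_betw \<phi> {r..<r + k} X"
    by (rule iffD1[OF bij_betw_cong g]) (simp add: \<phi>_def)
  ultimately have bij: "bij_betw \<phi> (pverts ?B) (S \<union> X)"
    unfolding pB using disj by (rule bij_betw_combine)
  define H where "H = \<lparr>pverts = S \<union> X, parcs = map_prod \<phi> \<phi> ` parcs ?B\<rparr>"
  have inj: "inj_on \<phi> (pverts ?B)" and img: "\<phi> ` pverts ?B = S \<union> X" using bij by (auto simp: bij_betw_def)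
  note B = pair_graph_props[OF pair_graph_generalized_book[of r k]]
  have Hsub: "parcs H \<subseteq> pverts H \<times> pverts H"
    using B(4) img unfolding H_def by fastforce
  then have wfH: "pair_wf_digraph H" by unfold_locales auto
  have SX: "(s, x) \<in> parcs G" "(x, s) \<in> parcs G" if "s \<in> S" "x \<in> X" for s x
    using X(1) that symD[OF props(2)] by (auto simp: common_nbrs_def)
  have "parcs H \<subseteq> parcs G"
  proof
    fix e assume "e \<in> parcs H"
    then obtain i j where ij: "(i, j) \<in> parcs ?B" and e: "e = (\<phi> i, \<phi> j)" by (auto simp: H_def)
    from ij have "(i < r \<and> j < r \<and> i \<noteq> j) \<or> (i < r \<and> r \<le> j \<and> j < r + k) \<or> (r \<le> i \<and> i < r + k \<and> j < r)"
      by (auto simp: generalized_book_def graph_join_def complete_graph_def edgeless_graph_def)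
    moreover have "f i \<noteq> f j" if "i < r" "j < r" "i \<noteq> j"
      using f that by (auto simp: bij_betw_def dest: inj_onD)
    ultimately show "e \<in> parcs G"
      using S(3) fi gi SX unfolding e \<phi>_def clique_def by auto
  qed
  moreover have "pverts H \<subseteq> pverts G" using S(1) X(1) by (auto simp: H_def common_nbrs_def)
  moreover have "wf_digraph (with_proj G)" "wf_digraph (with_proj H)"
    using props(4) Hsub by (auto simp: wf_digraph_def)
  ultimately have "subgraph (with_proj H) (with_proj G)"
    by (simp add: subgraph_def compatible_def)
  moreover have "graph_isomorphic H ?B"
  proof (rule graph_isomorphicI[OF wfH, where f = "inv_into (pverts ?B) \<phi>"])
    let ?g = "inv_into (pverts ?B) \<phi>"
    have "bij_betw ?g (S \<union> X) (pverts ?B)" by (rule bij_betw_inv_into[OF bij])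
    then show "inj_on ?g (pverts H)" "pverts ?B = ?g ` pverts H" by (auto simp: bij_betw_def H_def)
    have "map_prod ?g ?g ` parcs H = (\<lambda>e. e) ` parcs ?B"
      unfolding H_def pair_pre_digraph.simps image_image
    proof (intro image_cong refl)
      fix e assume "e \<in> parcs ?B"
      then have "fst e \<in> pverts ?B" "snd e \<in> pverts ?B" using B(4) by auto
      then show "map_prod ?g ?g (map_prod \<phi> \<phi> e) = e"
        using inj by (cases e) (simp add: inv_into_f_f)
    qed
    then show "parcs ?B = map_prod ?g ?g ` parcs H" by simp
  qed
  ultimately show False using free unfolding graph_free_def by blast
qed

lemma bij_betw_respecting_colours:
  fixes col :: "'a \<Rightarrow> 'c" and col' :: "'b \<Rightarrow> 'd"
  assumes fin: "finite W" "finite W'" and \<pi>: "bij_betw \<pi> K K'"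
    and col: "col ` W \<subseteq> K" "col' ` W' \<subseteq> K'"
    and card: "\<And>i. i \<in> K \<Longrightarrow> card {w \<in> W. col w = i} = card {w \<in> W'. col' w = \<pi> i}"
  shows "\<exists>f. bij_betw f W W' \<and> (\<forall>w\<in>W. col' (f w) = \<pi> (col w))"
proof -
  have "\<exists>h. bij_betw h {w \<in> W. col w = i} {w \<in> W'. col' w = \<pi> i}" if "i \<in> K" for i
    using finite_same_card_bij[OF _ _ card[OF that]] fin by simp
  then obtain h where h: "\<And>i. i \<in> K \<Longrightarrow> bij_betw (h i) {w \<in> W. col w = i} {w \<in> W'. col' w = \<pi> i}"
    by metis
  define f where "f w = h (col w) w" for w
  have fw: "f w \<in> W'" "col' (f w) = \<pi> (col w)" if "w \<in> W" for w
  proof -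
    have "col w \<in> K" using col(1) that by auto
    then have "h (col w) w \<in> {w' \<in> W'. col' w' = \<pi> (col w)}"
      using h[of "col w"] that by (auto simp: bij_betw_def)
    then show "f w \<in> W'" "col' (f w) = \<pi> (col w)" by (auto simp: f_def)
  qed
  have "inj_on f W"
  proof (rule inj_onI)
    fix u w assume uw: "u \<in> W" "w \<in> W" "f u = f w"
    have K: "col u \<in> K" "col w \<in> K" using uw col(1) by auto
    have "\<pi> (col u) = \<pi> (col w)" using fw(2)[OF uw(1)] fw(2)[OF uw(2)] uw(3) by simp
    then have c: "col u = col w" using \<pi> K by (auto simp: bij_betw_def dest: inj_onD)
    then have "h (col w) u = h (col w) w" using uw(3) by (simp add: f_def)
    then show "u = w" using h[OF K(2)] uw(1,2) c unfolding bij_betw_def inj_on_def by blast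
  qed
  moreover have "f ` W = W'"
  proof
    show "f ` W \<subseteq> W'" using fw(1) by auto
    show "W' \<subseteq> f ` W"
    proof
      fix w' assume w': "w' \<in> W'"
      then obtain i where i: "i \<in> K" "\<pi> i = col' w'" using \<pi> col(2) by (auto simp: bij_betw_def)
      then have "w' \<in> h i ` {w \<in> W. col w = i}" using h[OF i(1)] w' by (auto simp: bij_betw_def)
      then show "w' \<in> f ` W" by (auto simp: f_def)
    qed
  qed
  ultimately show ?thesis using fw(2) by (auto simp: bij_betw_def)
qed

lemma (in coloured_graph) card_large_parts:
  assumes "\<And>i. i \<in> K \<Longrightarrow> card (part i) = m \<or> card (part i) = m + 1"
  shows "card {i \<in> K. card (part i) = m + 1} + card K * m = card W"
proof -
  have "card W = (\<Sum>i\<in>K. card (part i))"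
    using sum_card_parts by (metis of_nat_eq_iff of_nat_sum)
  also have "\<dots> = (\<Sum>i\<in>K. m + (if card (part i) = m + 1 then 1 else 0))"
    using assms by (intro sum.cong) auto
  also have "\<dots> = card K * m + card {i \<in> K. card (part i) = m + 1}"
    by (simp add: sum.distrib sum.inter_filter[OF finite_K, symmetric])
  finally show ?thesis by simp
qed

text \<open>
  Both graphs have \<open>n mod r\<close> parts of the larger size, so the parts can be matched by size and then
  their vertices.
\<close>

lemma (in coloured_graph) balanced_bij_to_turan:
  assumes r: "card K = r" "r \<ge> 1"
    and bal: "\<And>i. i \<in> K \<Longrightarrow> card (part i) = card W div r \<or> card (part i) = card W div r + 1"
  shows "\<exists>f. bij_betw f W {..<card W} \<and>
    (\<forall>u\<in>W. \<forall>w\<in>W. col u \<noteq> col w \<longleftrightarrow> f u mod r \<noteq> f w mod r)"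
proof -
  define n m where "n = card W" and "m = n div r"
  have n: "n \<ge> 1" using finite_W W_nonempty by (simp add: n_def Suc_le_eq card_gt_0_iff)
  interpret T: coloured_graph "parcs (turan_graph n r)" "{..<n}" "{..<r}" "\<lambda>v. v mod r"
    by (rule turan_coloured_graph[OF n r(2)])
  have Tpart: "T.part i = {v. v < n \<and> v mod r = i}" for i by (auto simp: T.part_def)
  have bal': "card (part i) = m \<or> card (part i) = m + 1" if "i \<in> K" for i
    using bal[OF that] by (simp add: m_def n_def)
  have Tbal: "card (T.part i) = m \<or> card (T.part i) = m + 1" if "i \<in> {..<r}" for i
    using turan_part_cases[of i r n] that by (simp add: Tpart m_def)
  define L T where "L = {i \<in> K. card (part i) = m + 1}" and "T = {i \<in> {..<r}. card (T.part i) = m + 1}"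
  have "card L + r * m = n" using card_large_parts[OF bal'] by (simp add: L_def r n_def)
  moreover have "card T + r * m = n" using T.card_large_parts[OF Tbal] by (simp add: T_def)
  ultimately have LT: "card L = card T" by simp
  have sub: "L \<subseteq> K" "T \<subseteq> {..<r}" "finite L" "finite T" using finite_K by (auto simp: L_def T_def)
  have "card (K - L) = card ({..<r} - T)"
    using sub LT r finite_K by (simp add: card_Diff_subset)
  then obtain p1 where p1: "bij_betw p1 (K - L) ({..<r} - T)"
    using finite_same_card_bij[of "K - L" "{..<r} - T"] finite_K by auto
  obtain p2 where p2: "bij_betw p2 L T" using finite_same_card_bij[OF sub(3,4) LT] by auto
  define \<pi> where "\<pi> i = (if i \<in> L then p2 i else p1 i)" for i
  have "bij_betw \<pi> L T"
    by (rule iffD1[OF bij_betw_cong p2]) (simp add: \<pi>_def)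
  moreover have "bij_betw \<pi> (K - L) ({..<r} - T)"
    by (rule iffD1[OF bij_betw_cong p1]) (simp add: \<pi>_def)
  ultimately have "bij_betw \<pi> (L \<union> (K - L)) (T \<union> ({..<r} - T))" by (rule bij_betw_combine) auto
  moreover have "L \<union> (K - L) = K" "T \<union> ({..<r} - T) = {..<r}" using sub by auto
  ultimately have \<pi>: "bij_betw \<pi> K {..<r}" by simp
  have \<pi>L: "\<pi> i \<in> T \<longleftrightarrow> i \<in> L" if "i \<in> K" for i
    using p1 p2 that by (auto simp: \<pi>_def bij_betw_def)
  have "\<exists>f. bij_betw f W {..<n} \<and> (\<forall>w\<in>W. f w mod r = \<pi> (col w))"
  proof (rule bij_betw_respecting_colours[OF finite_W finite_lessThan \<pi> col_K])
    show "(\<lambda>v. v mod r) ` {..<n} \<subseteq> {..<r}" using r(2) by auto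
    fix i assume i: "i \<in> K"
    then have \<pi>i: "\<pi> i \<in> {..<r}" using \<pi> by (auto simp: bij_betw_def)
    have "card (part i) = card (T.part (\<pi> i))"
      using bal'[OF i] Tbal[OF \<pi>i] \<pi>L[OF i] i \<pi>i by (auto simp: L_def T_def)
    then show "card {w \<in> W. col w = i} = card {w \<in> {..<n}. w mod r = \<pi> i}"
      unfolding part_def T.part_def .
  qed
  then obtain f where f: "bij_betw f W {..<n}" "\<forall>w\<in>W. f w mod r = \<pi> (col w)" by auto
  have "col u \<noteq> col w \<longleftrightarrow> f u mod r \<noteq> f w mod r" if "u \<in> W" "w \<in> W" for u w
    using f(2) that \<pi> col_K unfolding bij_betw_def inj_on_def by (metis image_subset_iff)
  with f(1) show ?thesis by (auto simp: n_def)
qed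

section \<open>The extremal theorem\<close>

lemma turan_lower_bound_gt_order:
  assumes "r \<ge> 3" "n > 2 * r"
  shows "real n < 2 * (1 - 1 / real r) * real n - 2 * real r / real n"
proof -
  have "1 / real r \<le> 1 / 3" using assms by (intro divide_left_mono) auto
  then have "4 / 3 * real n \<le> 2 * (1 - 1 / real r) * real n"
    by (intro mult_right_mono) auto
  moreover have "2 * real r / real n < 1" using assms by simp
  moreover have "real n \<ge> 7" using assms by simp
  ultimately show ?thesis by linarith
qed

theorem corollary2p3:
  fixes r k :: nat
  assumes "r \<ge> 3" and "k \<ge> 1"
  shows "\<exists>N. \<forall>n\<ge>N. \<forall>G :: 'a pair_pre_digraph.
           pair_graph G \<and> card (pverts G) = n \<and> graph_free (generalized_book r k) G \<longrightarrow>
             signless_laplacian_radius G \<le> signless_laplacian_radius (turan_graph n r) \<and>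
             (signless_laplacian_radius G = signless_laplacian_radius (turan_graph n r) \<longleftrightarrow>
              graph_isomorphic G (turan_graph n r))"
proof -
  define B where "B = size_bound r k * 2 powr (1 / kappa r)"
  have main: "signless_laplacian_radius G \<le> signless_laplacian_radius (turan_graph n r) \<and>
             (signless_laplacian_radius G = signless_laplacian_radius (turan_graph n r) \<longleftrightarrow>
              graph_isomorphic G (turan_graph n r))"
    if G: "pair_graph G" "card (pverts G) = n" "graph_free (generalized_book r k) G"
      and n: "real n \<ge> B" "real n > 2 * real r / kappa r" "n > 2 * r"
    for n and G :: "'a pair_pre_digraph"
  proof -
    let ?E = "parcs G" and ?V = "pverts G" and ?T = "turan_graph n r"
    note props = pair_graph_props[OF G(1)]
    have n1: "n \<ge> 1" and r1: "r \<ge> 1" using n(3) assms by auto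
    have ne: "?V \<noteq> {}" using G(2) n1 by auto
    have TV: "pverts ?T = {..<n}" by (simp add: turan_graph_def)
    have "{..<n} \<noteq> {}" using n1 by (auto simp: lessThan_empty_iff)
    then have qT: "signless_laplacian_radius ?T = turan_index n r"
      using signless_laplacian_radius_eq_sl_index[OF pair_graph_turan_graph[of n r]] by (simp add: TV)
    have qG: "signless_laplacian_radius G = sl_index ?E ?V"
      by (rule signless_laplacian_radius_eq_sl_index[OF G(1) ne])
    have eq_if_iso: "sl_index ?E ?V = turan_index n r" if iso: "graph_isomorphic G ?T"
    proof -
      obtain f where "bij_betw f ?V (pverts ?T)"
        "\<And>u v. u \<in> ?V \<Longrightarrow> v \<in> ?V \<Longrightarrow> (f u, f v) \<in> parcs ?T \<longleftrightarrow> (u, v) \<in> ?E"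
        using graph_isomorphicE[OF iso props(4)] by blast
      from sl_index_iso[OF props(1) ne this] show ?thesis by (simp add: TV)
    qed
    have iso_if_ge: "sl_index ?E ?V = turan_index n r \<and> graph_isomorphic G ?T"
      if ge: "sl_index ?E ?V \<ge> turan_index n r"
    proof -
      have large: "sl_index ?E ?V \<ge> 2 * (1 - 1 / real r) * real n - 2 * real r / real n"
        using turan_index_ge_average[OF n1 r1] ge by linarith
      have str: "(\<forall>u\<in>?V. real n < 2 * real (card (nbrs ?E ?V u))) \<and>
        (\<exists>K :: 'a set. \<exists>c. finite K \<and> card K = r \<and> c ` ?V \<subseteq> K \<and>
          (\<forall>u\<in>?V. \<forall>w\<in>?V. (u, w) \<in> ?E \<longrightarrow> c u \<noteq> c w))"
        using near_extremal_book_free_is_colourable[OF assms(1) props(1-3) book_free_of_graph_free[OF G(1,3)]]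
          n large unfolding B_def G(2) by blast
      then obtain K :: "'a set" and c where c: "finite K" "card K = r" "c ` ?V \<subseteq> K"
        "\<forall>u\<in>?V. \<forall>w\<in>?V. (u, w) \<in> ?E \<longrightarrow> c u \<noteq> c w" by blast
      interpret coloured_graph ?E ?V K c
        using props ne c by unfold_locales auto
      have big: "sl_index ?E ?V > real (card ?V)"
        using turan_lower_bound_gt_order[OF assms(1) n(3)] large G(2) by simp
      have deg: "\<forall>u\<in>?V. real (card ?V) < 2 * real (card (nbrs ?E ?V u))"
        using str G(2) by blast
      note cmp = compare_with_turan[OF c(2) r1 big ge[folded G(2)] deg]
      obtain f where f: "bij_betw f ?V {..<n}"
        "\<And>u w. u \<in> ?V \<Longrightarrow> w \<in> ?V \<Longrightarrow> c u \<noteq> c w \<longleftrightarrow> f u mod r \<noteq> f w mod r"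
        using balanced_bij_to_turan[OF c(2) r1 cmp(2)] unfolding G(2) by blast
      have fn: "f u < n" if "u \<in> ?V" for u using f(1) that by (auto simp: bij_betw_def)
      have "graph_isomorphic G ?T"
      proof (rule graph_isomorphicI[OF props(5), where f = f])
        show "inj_on f ?V" "pverts ?T = f ` ?V" using f(1) by (auto simp: bij_betw_def TV)
        show "parcs ?T = map_prod f f ` ?E"
        proof (intro equalityI subsetI)
          fix e assume "e \<in> map_prod f f ` ?E"
          then obtain u w where uw: "(u, w) \<in> ?E" "e = (f u, f w)" by auto
          then have V: "u \<in> ?V" "w \<in> ?V" using props(4) by auto
          then show "e \<in> parcs ?T"
            using cmp(3)[OF V] f(2)[OF V] uw fn by (simp add: turan_graph_def)
        next
          fix e assume e: "e \<in> parcs ?T"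
          then obtain a b where ab: "e = (a, b)" "a < n" "b < n" "a mod r \<noteq> b mod r"
            by (auto simp: turan_graph_def)
          then obtain u w where V: "u \<in> ?V" "w \<in> ?V" "a = f u" "b = f w"
            using f(1) by (auto simp: bij_betw_def) (metis imageE lessThan_iff)
          then have "(u, w) \<in> ?E" using cmp(3)[OF V(1,2)] f(2)[OF V(1,2)] ab by simp
          then show "e \<in> map_prod f f ` ?E" using ab V by force
        qed
      qed
      then show ?thesis using cmp(1) G(2) by simp
    qed
    show ?thesis unfolding qT qG using eq_if_iso iso_if_ge by force
  qed
  define N where "N = nat \<lceil>B\<rceil> + nat \<lceil>2 * real r / kappa r\<rceil> + 2 * r + 1"
  show ?thesis
  proof (intro exI[of _ N] allI impI)
    fix n and G :: "'a pair_pre_digraph"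
    assume "N \<le> n" and G: "pair_graph G \<and> card (pverts G) = n \<and> graph_free (generalized_book r k) G"
    then have N: "nat \<lceil>B\<rceil> \<le> n" "nat \<lceil>2 * real r / kappa r\<rceil> < n" "n > 2 * r"
      unfolding N_def by linarith+
    have n: "real n \<ge> B" "real n > 2 * real r / kappa r"
      using order_trans[OF real_nat_ceiling_ge of_nat_mono[OF N(1)]]
        le_less_trans[OF real_nat_ceiling_ge of_nat_less_iff[THEN iffD2, OF N(2)]] by blast+
    from G have "pair_graph G" "card (pverts G) = n" "graph_free (generalized_book r k) G" by auto
    then show "signless_laplacian_radius G \<le> signless_laplacian_radius (turan_graph n r) \<and>
             (signless_laplacian_radius G = signless_laplacian_radius (turan_graph n r) \<longleftrightarrow>
              graph_isomorphic G (turan_graph n r))"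
      by (rule main[OF _ _ _ n N(3)])
  qed
qed

end
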